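(* Let $u$ be a smooth solution on $[0,T]$ of the rotating Euler equations $$\partial_t u + u\cdot\nabla u + \nabla\pi + 2\Omega\, e_3\times u = 0,\qquad \nabla\cdot u = 0,$$ in $R$ with $u\cdot n=0$ on $\partial R$, and consider the Lagrangian map $X(a,t)$ associated to the relative velocity $u$. Let $\omega=\nabla\times u$ and $\zeta(a)=\omega(a,0)$. Then $$\frac{\partial X_3}{\partial a_3}(a,t)=1+\frac{1}{2\Omega}\left(\omega_3(X(a,t),t)-\zeta(a)\cdot\frac{\partial X}{\partial a_3}(a,t)\right)$$ holds. If, moreover, on a time interval $I\subset[0,T]$ the displacement $\ell(x,t)=A(x,t)-x$ satisfies $$\sup_{t\in I}\|\nabla\ell(\cdot,t)\|_{L^\infty}\le\frac14$$ and the local Rossby number $$\rho=\frac{\sup_{0\le t\le T}\|\omega(\cdot,t)\|_{L^\infty(dx)}}{\Omega}$$ does not exceed $1/4$, then $$\sup_{t\in I}\left\|\partial_{a_3}\big(X(a,t)-a\big)\right\|_{L^\infty(da)}\le 9\rho .$$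
   Context: $\Omega>0$ is a constant (angular velocity) and $e_3$ is the unit vector of the third Cartesian direction (the rotation axis). $R\subset\mathbb R^3$ is an open domain with smooth boundary $\partial R$ and normal $n$. The Lagrangian path map is the solution of $\partial_t X(a,t)=u(X(a,t),t)$, $X(a,0)=a$, and $A(\cdot,t)=X(\cdot,t)^{-1}$ is its inverse (the back-to-labels map). It is assumed that $\sup_{0\le t\le T}\|\omega(\cdot,t)\|_{L^\infty}<\infty$. $\|\nabla\ell\|_{L^\infty}$ is the supremum over $x$ of the Euclidean operator norm of the $3\times3$ matrix $\nabla\ell(x,t)$.
   Formalization: In the identity, ζ(a)·∂X/∂a_3(a,t) is replaced by ζ(a)·∇_a X_3(a,t), the form given by Cauchy's formula; the printed form is false, e.g. for u = x_3(cos 2Ωt, −sin 2Ωt, 0), π = 0 on the slab 0 < x_3 < 1. *)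

theory Defs
  imports "HOL-Analysis.Analysis" "HOL-Probability.Essential_Supremum"
begin

section \<open>Smooth functions\<close>

primrec Ck_on :: "nat \<Rightarrow> 'a::euclidean_space set \<Rightarrow> ('a \<Rightarrow> 'b::euclidean_space) \<Rightarrow> bool" where
  "Ck_on 0 U g \<longleftrightarrow> continuous_on U g"
| "Ck_on (Suc k) U g \<longleftrightarrow> (\<forall>x\<in>U. g differentiable (at x)) \<and>
     (\<forall>v. Ck_on k U (\<lambda>x. frechet_derivative g (at x) v))"

text \<open>\<^const>\<open>Ck_on\<close> is meant for open sets only. On an arbitrary set (such as the closed
  set \<open>[0,T]\<close> times the closure of a domain) smoothness means local extendability to a smooth
  function on an open set.\<close>

definition smooth_on :: "'a::euclidean_space set \<Rightarrow> ('a \<Rightarrow> 'b::euclidean_space) \<Rightarrow> bool" where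
  "smooth_on S f \<longleftrightarrow>
     (\<forall>z\<in>S. \<exists>U g. open U \<and> z \<in> U \<and> (\<forall>k. Ck_on k U g) \<and> (\<forall>y\<in>S \<inter> U. g y = f y))"


section \<open>Vector calculus in three dimensions\<close>

definition partial :: "3 \<Rightarrow> (real^3 \<Rightarrow> 'b::real_normed_vector) \<Rightarrow> real^3 \<Rightarrow> 'b" where
  "partial j f x = frechet_derivative f (at x) (axis j 1)"

definition grad :: "(real^3 \<Rightarrow> real) \<Rightarrow> real^3 \<Rightarrow> real^3" where
  "grad f x = (\<chi> j. partial j f x)"

definition divergence :: "(real^3 \<Rightarrow> real^3) \<Rightarrow> real^3 \<Rightarrow> real" where
  "divergence v x = (\<Sum>j\<in>UNIV. partial j (\<lambda>y. v y $ j) x)"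

definition curl :: "(real^3 \<Rightarrow> real^3) \<Rightarrow> real^3 \<Rightarrow> real^3" where
  "curl v x = vector
     [partial 2 (\<lambda>y. v y $ 3) x - partial 3 (\<lambda>y. v y $ 2) x,
      partial 3 (\<lambda>y. v y $ 1) x - partial 1 (\<lambda>y. v y $ 3) x,
      partial 1 (\<lambda>y. v y $ 2) x - partial 2 (\<lambda>y. v y $ 1) x]"

definition advection :: "(real^3 \<Rightarrow> real^3) \<Rightarrow> (real^3 \<Rightarrow> real^3) \<Rightarrow> real^3 \<Rightarrow> real^3" where
  "advection v w x = (\<Sum>j\<in>UNIV. v x $ j *\<^sub>R partial j w x)"

abbreviation e3 :: "real^3" where
  "e3 \<equiv> axis 3 1"


section \<open>Norms\<close>

definition Linf_norm :: "(real^3) set \<Rightarrow> (real^3 \<Rightarrow> real^3) \<Rightarrow> ennreal" where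
  "Linf_norm R f = esssup (lebesgue_on R) (\<lambda>x. ennreal (norm (f x)))"

definition sup_grad_norm :: "(real^3) set \<Rightarrow> (real^3 \<Rightarrow> real^3) \<Rightarrow> ennreal" where
  "sup_grad_norm R f = (SUP x\<in>R. ennreal (onorm (frechet_derivative f (at x))))"


section \<open>Domains with smooth boundary\<close>

text \<open>Near each boundary point the domain is the negativity set of a smooth function \<open>\<phi>\<close> with
  nowhere vanishing gradient; \<open>n\<close> is the outward unit normal.\<close>

definition smooth_domain :: "(real^3) set \<Rightarrow> (real^3 \<Rightarrow> real^3) \<Rightarrow> bool" where
  "smooth_domain R n \<longleftrightarrow> open R \<and> connected R \<and> R \<noteq> {} \<and>
     (\<forall>z\<in>frontier R. \<exists>U (\<phi> :: real^3 \<Rightarrow> real).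
        open U \<and> z \<in> U \<and> smooth_on U \<phi> \<and> (\<forall>x\<in>U. grad \<phi> x \<noteq> 0) \<and>
        R \<inter> U = {x\<in>U. \<phi> x < 0} \<and> n z = sgn (grad \<phi> z))"


section \<open>The rotating Euler equations and Lagrangian paths\<close>

definition rotating_euler_solution ::
  "real \<Rightarrow> (real^3) set \<Rightarrow> (real^3 \<Rightarrow> real^3) \<Rightarrow> real \<Rightarrow>
   (real \<Rightarrow> real^3 \<Rightarrow> real^3) \<Rightarrow> (real \<Rightarrow> real^3 \<Rightarrow> real) \<Rightarrow> bool" where
  "rotating_euler_solution \<Omega> R n T u p \<longleftrightarrow>
     smooth_on {(t, x). t \<in> {0..T} \<and> x \<in> closure R} (\<lambda>(t, x). u t x) \<and>
     smooth_on {(t, x). t \<in> {0..T} \<and> x \<in> closure R} (\<lambda>(t, x). p t x) \<and>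
     (\<forall>t\<in>{0..T}. \<forall>x\<in>R.
        vector_derivative (\<lambda>s. u s x) (at t within {0..T}) + advection (u t) (u t) x
          + grad (p t) x + (2 * \<Omega>) *\<^sub>R cross3 e3 (u t x) = 0 \<and>
        divergence (u t) x = 0) \<and>
     (\<forall>t\<in>{0..T}. \<forall>x\<in>frontier R. u t x \<bullet> n x = 0)"

text \<open>Time derivatives are one-sided at \<open>0\<close> and \<open>T\<close>. No regularity of the path map in the label is
  assumed; it follows from smoothness of the velocity.\<close>

definition lagrangian_map ::
  "(real^3) set \<Rightarrow> real \<Rightarrow> (real \<Rightarrow> real^3 \<Rightarrow> real^3) \<Rightarrow> (real \<Rightarrow> real^3 \<Rightarrow> real^3) \<Rightarrow> bool" where
  "lagrangian_map R T u X \<longleftrightarrow>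
     (\<forall>a\<in>R. X 0 a = a \<and>
        (\<forall>t\<in>{0..T}. X t a \<in> R \<and>
           ((\<lambda>s. X s a) has_vector_derivative u t (X t a)) (at t within {0..T})))"

definition back_to_labels ::
  "(real^3) set \<Rightarrow> real \<Rightarrow> (real \<Rightarrow> real^3 \<Rightarrow> real^3) \<Rightarrow> (real \<Rightarrow> real^3 \<Rightarrow> real^3) \<Rightarrow> bool" where
  "back_to_labels R T X A \<longleftrightarrow>
     (\<forall>t\<in>{0..T}. (\<forall>a\<in>R. A t (X t a) = a) \<and> (\<forall>x\<in>R. A t x \<in> R \<and> X t (A t x) = x))"

definition sup_vorticity :: "(real^3) set \<Rightarrow> real \<Rightarrow> (real \<Rightarrow> real^3 \<Rightarrow> real^3) \<Rightarrow> ennreal" where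
  "sup_vorticity R T u = (SUP t\<in>{0..T}. Linf_norm R (curl (u t)))"

definition local_rossby ::
  "real \<Rightarrow> (real^3) set \<Rightarrow> real \<Rightarrow> (real \<Rightarrow> real^3 \<Rightarrow> real^3) \<Rightarrow> ennreal" where
  "local_rossby \<Omega> R T u = sup_vorticity R T u / ennreal \<Omega>"

end

theory Submission
  imports Defs
begin

text \<open>
The absolute vorticity \<open>W = \<omega> + 2 \<Omega> e\<^sub>3\<close> of a rotating incompressible ideal fluid is frozen into
the flow. Along a particle path, both \<open>W\<close> and every column of the flow gradient \<open>\<nabla>X\<close> solve the linear
equation \<open>y' = (\<nabla>u)(X(a,t),t) y\<close>, so that Cauchy's formula holds:

  \<open>\<omega>(X(a,t),t) + 2 \<Omega> e\<^sub>3 = \<nabla>X(a,t) (\<zeta>(a) + 2 \<Omega> e\<^sub>3)\<close>.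

Its vertical component, divided by \<open>2 \<Omega>\<close>, is the identity for \<open>\<partial>X\<^sub>3/\<partial>a\<^sub>3\<close>
(\<open>vertical_stretching_identity\<close>). In vector form it gives
\<open>\<partial>\<^sub>3(X - id) = (\<omega>(X,t) - \<nabla>X \<zeta>) / (2 \<Omega>)\<close>. Since \<open>\<nabla>X\<close> is the inverse of
\<open>\<nabla>A = id + \<nabla>\<ell>\<close>, the assumption on \<open>\<nabla>\<ell>\<close> bounds it by \<open>4/3\<close>, and the right-hand side is then a
multiple of \<open>\<rho>\<close> (\<open>stretching_bound\<close>).

Two facts carry this. The first is that \<open>X\<close> is differentiable in the label with the solution of
the linearized equation as derivative (\<open>flow_has_derivative\<close>). It rests on the existence of the
fundamental solution of a linear equation (\<open>fundamental_solution\<close>, from a global Picard theorem)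
and on Gronwall's inequality in a compact tube around one path. The second is the
equation for \<open>W\<close> (\<open>absolute_vorticity_evolution\<close>). Differentiating the momentum equation in space
gives a Riccati equation for \<open>\<nabla>u\<close> along the path (\<open>velocity_gradient_evolution\<close>), in which the
pressure enters through its symmetric Hessian; its curl is linear because \<open>\<nabla>u\<close> has trace zero.
\<close>

section \<open>Linear differential equations on a compact interval\<close>

text \<open>\<open>exp (- 2 * C * s) * (norm (y s))\<^sup>2\<close> has nonpositive derivative. The growth bound is
  asked for only strictly before the final time: in the confinement argument for the flow it is
  known up to, but not at, the first exit time.\<close>

lemma gronwall_norm:
  fixes y y' :: "real \<Rightarrow> 'a::real_inner"
  assumes der: "\<And>s. s \<in> {0..t} \<Longrightarrow> (y has_vector_derivative y' s) (at s within {0..t})"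
    and bound: "\<And>s. 0 < s \<Longrightarrow> s < t \<Longrightarrow> norm (y' s) \<le> C * norm (y s)"
    and "0 \<le> t"
  shows "norm (y t) \<le> exp (C * t) * norm (y 0)"
proof -
  define \<phi> where "\<phi> s = exp (- 2 * C * s) * (y s \<bullet> y s)" for s
  have cont: "continuous_on {0..t} y"
    using der by (meson continuous_on_eq_continuous_within has_vector_derivative_continuous)
  have "\<phi> t \<le> \<phi> 0"
  proof (rule DERIV_nonpos_imp_decreasing_open[of 0 t \<phi>])
    show "0 \<le> t" by fact
    show "continuous_on {0..t} \<phi>"
      unfolding \<phi>_def by (intro continuous_intros cont)
  next
    fix s :: real
    assume s: "0 < s" "s < t"
    then have "(y has_vector_derivative y' s) (at s)"
      using der[of s] by (simp add: at_within_Icc_at)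
    then have "((\<lambda>s. y s \<bullet> y s) has_real_derivative 2 * (y s \<bullet> y' s)) (at s)"
      unfolding has_vector_derivative_def has_field_derivative_def
      by (auto intro!: derivative_eq_intros simp: inner_commute fun_eq_iff algebra_simps)
    then have "(\<phi> has_real_derivative
        2 * exp (- 2 * C * s) * (y s \<bullet> y' s - C * (y s \<bullet> y s))) (at s)"
      unfolding \<phi>_def
      by (auto intro!: derivative_eq_intros simp: algebra_simps)
    moreover have "y s \<bullet> y' s \<le> C * (y s \<bullet> y s)"
    proof -
      have "y s \<bullet> y' s \<le> norm (y s) * norm (y' s)"
        by (rule norm_cauchy_schwarz)
      also have "\<dots> \<le> norm (y s) * (C * norm (y s))"
        using bound[of s] s by (intro mult_left_mono) auto
      finally show ?thesis
        by (simp add: dot_square_norm power2_eq_square mult_ac)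
    qed
    then have "2 * exp (- 2 * C * s) * (y s \<bullet> y' s - C * (y s \<bullet> y s)) \<le> 0"
      by (simp add: mult_nonneg_nonpos)
    ultimately show "\<exists>d. (\<phi> has_real_derivative d) (at s) \<and> d \<le> 0"
      by blast
  qed
  then have "exp (- 2 * C * t) * (norm (y t))\<^sup>2 \<le> (norm (y 0))\<^sup>2"
    by (simp add: \<phi>_def dot_square_norm)
  then have "exp (2 * C * t) * (exp (- 2 * C * t) * (norm (y t))\<^sup>2) \<le> exp (2 * C * t) * (norm (y 0))\<^sup>2"
    by (intro mult_left_mono) auto
  moreover have sq: "(exp (C * t))\<^sup>2 = exp (2 * C * t)"
    by (simp add: mult.assoc flip: exp_double)
  ultimately have "(norm (y t))\<^sup>2 \<le> (exp (C * t) * norm (y 0))\<^sup>2"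
    by (simp add: power_mult_distrib mult.assoc[symmetric] exp_add[symmetric] sq)
  then show ?thesis
    by (rule power2_le_imp_le) simp
qed

text \<open>In the norm weighted by \<open>exp (- 2 * K * t)\<close>, with \<open>K\<close> a positive Lipschitz constant, the Picard
  operator contracts by the factor \<open>1/2\<close> on the whole interval at once, so no continuation from
  short intervals is needed. The weight is put on the unknown: the fixed point is sought for
  \<open>g t = y t / exp (2 * K * t)\<close>.\<close>

lemma picard_lindelof_global:
  fixes f :: "real \<Rightarrow> 'a::banach \<Rightarrow> 'a"
  assumes "0 \<le> T"
    and cont: "continuous_on ({0..T} \<times> UNIV) (\<lambda>(t, y). f t y)"
    and lip: "\<And>t x y. t \<in> {0..T} \<Longrightarrow> norm (f t x - f t y) \<le> C * norm (x - y)"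
  obtains y where "y 0 = y0"
    and "\<And>t. t \<in> {0..T} \<Longrightarrow> (y has_vector_derivative f t (y t)) (at t within {0..T})"
proof -
  define K where "K = \<bar>C\<bar> + 1"
  have K: "K > 0" by (simp add: K_def)
  have lipK: "norm (f t x - f t y) \<le> K * norm (x - y)" if "t \<in> {0..T}" for t x y
    using lip[OF that, of x y] unfolding K_def
    by (smt (verit) mult_right_mono norm_ge_zero)
  define w where "w s = exp (2 * K * s)" for s
  define Q where "Q g s = f s (w s *\<^sub>R g s)" for g s
  have contQ: "continuous_on {0..T} (Q g)" if "continuous_on {0..T} g" for g
    unfolding Q_def w_def
    by (intro continuous_on_compose2[OF cont, of "{0..T}" "\<lambda>s. (s, exp (2 * K * s) *\<^sub>R g s)",
          simplified] continuous_intros that) auto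
  define P where "P g t = y0 + integral {0..t} (Q g)" for g t
  have derP: "(P g has_vector_derivative Q g t) (at t within {0..T})"
    if "continuous_on {0..T} g" "t \<in> {0..T}" for g t
    unfolding P_def
    using integral_has_vector_derivative[OF contQ[OF that(1)] that(2)]
    by (auto intro!: derivative_eq_intros)
  have contP: "continuous_on {0..T} (P g)" if "continuous_on {0..T} g" for g
    using derP[OF that]
    by (meson continuous_on_eq_continuous_within has_vector_derivative_continuous)
  \<comment> \<open>The Banach space is that of bounded
    continuous functions on the whole line; clamping the time extends a function on
    \<open>{0..T}\<close> to it by constants.\<close>
  have "\<exists>h :: real \<Rightarrow>\<^sub>C 'a. \<forall>x. h x = P g (clamp 0 T x) /\<^sub>R w (clamp 0 T x)"
    for g :: "real \<Rightarrow>\<^sub>C 'a"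
  proof -
    have "continuous_on (cbox 0 T) (\<lambda>t. P g t /\<^sub>R w t)"
      unfolding cbox_interval w_def by (intro continuous_intros contP) auto
    from continuous_on_cbox_bcontfunE[OF this] show ?thesis by metis
  qed
  then obtain \<Phi> :: "(real \<Rightarrow>\<^sub>C 'a) \<Rightarrow> real \<Rightarrow>\<^sub>C 'a"
    where \<Phi>: "\<And>g x. \<Phi> g x = P g (clamp 0 T x) /\<^sub>R w (clamp 0 T x)" by metis
  have contr: "dist (\<Phi> g) (\<Phi> h) \<le> 1/2 * dist g h" for g h
  proof (rule dist_bound)
    fix x
    define t where "t = clamp 0 T x"
    have t: "0 \<le> t" "t \<le> T"
      using clamp_in_interval[of "0::real" T x] \<open>0 \<le> T\<close> by (auto simp: t_def cbox_interval)
    have w_pos: "w s > 0" for s by (simp add: w_def)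
    have int: "Q (apply_bcontfun g) integrable_on {0..t}" for g :: "real \<Rightarrow>\<^sub>C 'a"
      by (rule integrable_continuous_real, rule continuous_on_subset[OF contQ]) (use t in auto)
    have wint: "((\<lambda>s. K * dist g h * w s) has_integral
        (1/2 * dist g h * w t - 1/2 * dist g h * w 0)) {0..t}"
      by (rule fundamental_theorem_of_calculus[OF t(1)])
        (auto simp: w_def has_real_derivative_iff_has_vector_derivative[symmetric]
          intro!: derivative_eq_intros)
    have "norm (P g t - P h t) = norm (integral {0..t} (\<lambda>s. Q g s - Q h s))"
      by (simp add: P_def integral_diff int)
    also have "\<dots> \<le> integral {0..t} (\<lambda>s. K * dist g h * w s)"
    proof (rule integral_norm_bound_integral)
      fix s assume s: "s \<in> {0..t}"
      have "norm (Q g s - Q h s) \<le> K * norm (w s *\<^sub>R g s - w s *\<^sub>R h s)"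
        unfolding Q_def using s t by (intro lipK) auto
      also have "\<dots> = K * (w s * dist (g s) (h s))"
        using w_pos[of s] by (simp add: dist_norm flip: scaleR_diff_right)
      also have "\<dots> \<le> K * (w s * dist g h)"
        using K w_pos[of s] dist_bounded[of g s h] by (intro mult_left_mono) auto
      finally show "norm (Q g s - Q h s) \<le> K * dist g h * w s" by (simp add: mult_ac)
    qed (use int wint in \<open>auto intro: integrable_diff\<close>)
    also have "\<dots> = 1/2 * dist g h * w t - 1/2 * dist g h * w 0"
      using wint by (rule integral_unique)
    also have "\<dots> \<le> 1/2 * dist g h * w t"
      using w_pos[of 0] by simp
    finally have "norm (P g t - P h t) / w t \<le> 1/2 * dist g h"
      using w_pos[of t] by (simp add: divide_le_eq)
    moreover have "dist (\<Phi> g x) (\<Phi> h x) = norm (P g t /\<^sub>R w t - P h t /\<^sub>R w t)"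
      by (simp only: \<Phi> t_def dist_norm)
    moreover have "\<dots> = norm ((P g t - P h t) /\<^sub>R w t)"
      by (simp only: scaleR_diff_right)
    moreover have "\<dots> = norm (P g t - P h t) / w t"
      using w_pos[of t] by (simp add: divide_inverse_commute)
    ultimately show "dist (\<Phi> g x) (\<Phi> h x) \<le> 1/2 * dist g h"
      by (simp only:)
  qed
  obtain g where g: "\<Phi> g = g"
    using banach_fix_type[of "1/2" \<Phi>] contr by auto
  define y where "y t = w t *\<^sub>R g t" for t
  have y: "y t = P g t" if "t \<in> {0..T}" for t
  proof -
    have "clamp 0 T t = t" using that by (intro clamp_cancel_cbox) (simp add: cbox_interval)
    then have "g t = P g t /\<^sub>R w t" using \<Phi>[of g t] g by simp
    then show ?thesis by (simp add: y_def w_def)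
  qed
  show ?thesis
  proof (rule that)
    show "y 0 = y0" using y[of 0] \<open>0 \<le> T\<close> by (simp add: P_def)
    fix t assume t: "t \<in> {0..T}"
    have "(P g has_vector_derivative f t (y t)) (at t within {0..T})"
      using derP[OF _ t, of g] by (simp add: Q_def y_def)
    then show "(y has_vector_derivative f t (y t)) (at t within {0..T})"
      by (rule has_vector_derivative_transform[OF t, rotated]) (simp add: y)
  qed
qed

text \<open>\<open>M\<close> is the fundamental solution of the linear equation \<open>y' = B y\<close>. Its inverse \<open>N\<close> is built as the
  solution of the adjoint equation, because \<open>N\<close> has two uses: a solution \<open>y\<close> of the
  linear equation has \<open>N y\<close> constant, and a perturbed one has a derivative of \<open>N y\<close> that
  contains the perturbation only (variation of constants). Both give \<open>y = M (y 0)\<close> up to an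
  explicit error.\<close>

lemma fundamental_solution:
  fixes B :: "real \<Rightarrow> 'a::euclidean_space \<Rightarrow>\<^sub>L 'a"
  assumes "0 \<le> T" and B: "continuous_on {0..T} B"
  obtains M N :: "real \<Rightarrow> 'a \<Rightarrow>\<^sub>L 'a"
  where "M 0 = id_blinfun" "N 0 = id_blinfun"
    and "\<And>t. t \<in> {0..T} \<Longrightarrow> (M has_vector_derivative B t o\<^sub>L M t) (at t within {0..T})"
    and "\<And>t. t \<in> {0..T} \<Longrightarrow> (N has_vector_derivative - (N t o\<^sub>L B t)) (at t within {0..T})"
    and "\<And>t v. t \<in> {0..T} \<Longrightarrow> M t (N t v) = v"
    and "\<And>t v. t \<in> {0..T} \<Longrightarrow> N t (M t v) = v"
proof -
  obtain C where C: "\<And>t. t \<in> {0..T} \<Longrightarrow> norm (B t) \<le> C"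
    using compact_imp_bounded[OF compact_continuous_image[OF B compact_Icc]]
    unfolding bounded_iff by blast
  have B': "continuous_on ({0..T} \<times> (UNIV :: ('a \<Rightarrow>\<^sub>L 'a) set)) (\<lambda>z. B (fst z))"
    by (rule continuous_on_compose2[OF B]) (auto intro!: continuous_intros)
  obtain M where M: "M 0 = id_blinfun"
    "\<And>t. t \<in> {0..T} \<Longrightarrow> (M has_vector_derivative B t o\<^sub>L M t) (at t within {0..T})"
  proof (rule picard_lindelof_global[of T "\<lambda>t Y. B t o\<^sub>L Y" C id_blinfun])
    show "continuous_on ({0..T} \<times> UNIV) (\<lambda>(t, Y :: 'a \<Rightarrow>\<^sub>L 'a). B t o\<^sub>L Y)"
      unfolding case_prod_beta by (intro continuous_intros B')
    fix t and x y :: "'a \<Rightarrow>\<^sub>L 'a" assume "t \<in> {0..T}"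
    then show "norm ((B t o\<^sub>L x) - (B t o\<^sub>L y)) \<le> C * norm (x - y)"
      using norm_blinfun_compose[of "B t" "x - y"] C[of t]
      by (simp add: bounded_bilinear.diff_right[OF bounded_bilinear_blinfun_compose])
        (meson mult_right_mono norm_ge_zero order_trans)
  qed (use \<open>0 \<le> T\<close> in auto)
  obtain N where N: "N 0 = id_blinfun"
    "\<And>t. t \<in> {0..T} \<Longrightarrow> (N has_vector_derivative - (N t o\<^sub>L B t)) (at t within {0..T})"
  proof (rule picard_lindelof_global[of T "\<lambda>t Y. - (Y o\<^sub>L B t)" C id_blinfun])
    show "continuous_on ({0..T} \<times> UNIV) (\<lambda>(t, Y :: 'a \<Rightarrow>\<^sub>L 'a). - (Y o\<^sub>L B t))"
      unfolding case_prod_beta by (intro continuous_intros B')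
    fix t and x y :: "'a \<Rightarrow>\<^sub>L 'a" assume "t \<in> {0..T}"
    then show "norm (- (x o\<^sub>L B t) - - (y o\<^sub>L B t)) \<le> C * norm (x - y)"
      using norm_blinfun_compose[of "y - x" "B t"] C[of t]
      by (simp add: bounded_bilinear.diff_left[OF bounded_bilinear_blinfun_compose] norm_minus_commute mult.commute)
        (meson mult_right_mono norm_ge_zero order_trans)
  qed (use \<open>0 \<le> T\<close> in auto)
  have NM: "N t o\<^sub>L M t = id_blinfun" if t: "t \<in> {0..T}" for t
  proof -
    have der: "((\<lambda>s. N s o\<^sub>L M s) has_vector_derivative 0) (at s within {0..T})"
      if "s \<in> {0..T}" for s
    proof -
      have "(N s o\<^sub>L (B s o\<^sub>L M s)) + ((- (N s o\<^sub>L B s)) o\<^sub>L M s) = 0"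
        by (rule blinfun_eqI) (simp add: blinfun.bilinear_simps)
      with bounded_bilinear.has_vector_derivative[OF bounded_bilinear_blinfun_compose
          N(2)[OF that] M(2)[OF that]]
      show ?thesis by simp
    qed
    obtain c where "\<And>s. s \<in> {0..T} \<Longrightarrow> N s o\<^sub>L M s = c"
      using has_vector_derivative_zero_constant[OF _ der] by auto
    moreover have "id_blinfun o\<^sub>L id_blinfun = (id_blinfun :: 'a \<Rightarrow>\<^sub>L 'a)"
      by (rule blinfun_eqI) simp
    ultimately show ?thesis
      using t \<open>0 \<le> T\<close> M(1) N(1) by (metis atLeastAtMost_iff order_refl)
  qed
  have NM': "N t (M t v) = v" if "t \<in> {0..T}" for t v
    using NM[OF that] by (metis blinfun_apply_blinfun_compose id_blinfun.rep_eq id_apply)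
  have MN': "M t (N t v) = v" if "t \<in> {0..T}" for t v
  proof -
    have "blinfun_apply (N t) \<circ> blinfun_apply (M t) = id"
      using NM'[OF that] by auto
    then have "blinfun_apply (M t) \<circ> blinfun_apply (N t) = id"
      using linear_inverse_left[of "blinfun_apply (M t)" "blinfun_apply (N t)"]
      by (auto intro: blinfun.bounded_linear_right bounded_linear.linear)
    then show ?thesis by (metis comp_apply id_apply)
  qed
  show ?thesis by (rule that[OF M(1) N(1) M(2) N(2) MN' NM'])
qed

section \<open>Differentiability of the flow in the initial point\<close>

text \<open>Here \<open>M\<close> is the value at time \<open>t\<close> of the fundamental solution of the equation linearized along the
  path of \<open>a\<close>. A path that starts at a nearby label \<open>b\<close> stays in a compact tube around the path of
  \<open>a\<close> and satisfies \<open>norm (X s b - X s a) \<le> G * norm (b - a)\<close> there, by Gronwall's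
  inequality. On the tube \<open>D\<close> is uniformly continuous, so the difference of the two
  paths solves the linearized equation up to an error \<open>\<epsilon> * G * norm (b - a)\<close>; after multiplication
  with \<open>N\<close> this error is all that drives the difference away from \<open>M (b - a)\<close>.\<close>

lemma flow_has_derivative:
  fixes v :: "real \<Rightarrow> 'a::euclidean_space \<Rightarrow> 'a" and D :: "real \<Rightarrow> 'a \<Rightarrow> 'a \<Rightarrow>\<^sub>L 'a"
    and N :: "real \<Rightarrow> 'a \<Rightarrow>\<^sub>L 'a" and M :: "'a \<Rightarrow>\<^sub>L 'a"
  assumes "open R"
    and D: "\<And>t x. t \<in> {0..T} \<Longrightarrow> x \<in> R \<Longrightarrow> (v t has_derivative D t x) (at x)"
    and contD: "continuous_on ({0..T} \<times> R) (\<lambda>(t, x). D t x)"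
    and X0: "\<And>a. a \<in> R \<Longrightarrow> X 0 a = a"
    and XR: "\<And>t a. t \<in> {0..T} \<Longrightarrow> a \<in> R \<Longrightarrow> X t a \<in> R"
    and dX: "\<And>t a. t \<in> {0..T} \<Longrightarrow> a \<in> R \<Longrightarrow>
      ((\<lambda>s. X s a) has_vector_derivative v t (X t a)) (at t within {0..T})"
    and a: "a \<in> R"
    and N0: "N 0 = id_blinfun"
    and dN: "\<And>t. t \<in> {0..T} \<Longrightarrow>
      (N has_vector_derivative - (N t o\<^sub>L D t (X t a))) (at t within {0..T})"
    and MN: "\<And>v. M (N t v) = v"
    and t: "t \<in> {0..T}"
  shows "(X t has_derivative blinfun_apply M) (at a)"
proof -
  have "0 \<le> T" using t by simp
  have contX: "continuous_on {0..T} (\<lambda>s. X s a)"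
    using dX[OF _ a] by (meson continuous_on_eq_continuous_within has_vector_derivative_continuous)
  define P where "P = (\<lambda>s. X s a) ` {0..T}"
  have "compact P" unfolding P_def by (rule compact_continuous_image[OF contX compact_Icc])
  moreover have "P \<subseteq> R" using XR[OF _ a] by (auto simp: P_def)
  ultimately obtain r where "r > 0" and r: "(\<Union>x\<in>P. cball x r) \<subseteq> R"
    using compact_subset_open_imp_cball_epsilon_subset[OF _ \<open>open R\<close>] by metis
  define K where "K = {x + y |x y. x \<in> P \<and> y \<in> cball 0 r}"
  have "compact K" unfolding K_def by (intro compact_sums \<open>compact P\<close> compact_cball)
  have cball_K: "cball (X s a) r \<subseteq> K" if "s \<in> {0..T}" for s
  proof
    fix y assume "y \<in> cball (X s a) r"
    then have "y = X s a + (y - X s a)" "y - X s a \<in> cball 0 r"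
      by (auto simp: dist_norm norm_minus_commute)
    then show "y \<in> K" using that unfolding K_def P_def by blast
  qed
  have "K \<subseteq> R"
  proof
    fix z assume "z \<in> K"
    then obtain x y where "z = x + y" "x \<in> P" "y \<in> cball 0 r" by (auto simp: K_def)
    then show "z \<in> R" using r by (force simp: dist_norm)
  qed
  have contK: "continuous_on ({0..T} \<times> K) (\<lambda>(t, x). D t x)"
    by (rule continuous_on_subset[OF contD]) (use \<open>K \<subseteq> R\<close> in auto)
  have compK: "compact ({0..T} \<times> K)"
    by (intro compact_Times compact_Icc \<open>compact K\<close>)
  obtain C where C: "\<And>s x. s \<in> {0..T} \<Longrightarrow> x \<in> K \<Longrightarrow> norm (D s x) \<le> C"
    using compact_imp_bounded[OF compact_continuous_image[OF contK compK]]
    unfolding bounded_iff by force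
  have "C \<ge> 0" 
    using C[of 0 "X 0 a"] cball_K[of 0] \<open>0 \<le> T\<close> \<open>r > 0\<close> norm_ge_zero[of "D 0 (X 0 a)"]
    by (smt (verit) atLeastAtMost_iff centre_in_cball subset_iff)
  define G where "G = exp (C * T)"
  have "G \<ge> 1" using \<open>C \<ge> 0\<close> \<open>0 \<le> T\<close> by (simp add: G_def)
  have lip: "norm (v s x - v s (X s a)) \<le> C * norm (x - X s a)"
    if "s \<in> {0..T}" "norm (x - X s a) \<le> r" for s x
  proof (rule differentiable_bound)
    show "convex (cball (X s a) r)" by (rule convex_cball)
    fix y assume y: "y \<in> cball (X s a) r"
    then have "y \<in> K" using cball_K[OF that(1)] by auto
    then show "(v s has_derivative D s y) (at y within cball (X s a) r)"
      using D[OF that(1) subsetD[OF \<open>K \<subseteq> R\<close>]] has_derivative_at_withinI by blast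
    show "onorm (D s y) \<le> C"
      using C[OF that(1) \<open>y \<in> K\<close>] by (simp add: norm_blinfun.rep_eq)
  qed (use that \<open>r > 0\<close> in \<open>auto simp: dist_norm norm_minus_commute\<close>)
  have dE: "((\<lambda>s. X s b - X s a) has_vector_derivative v s (X s b) - v s (X s a)) (at s within {0..T})"
    if "b \<in> R" "s \<in> {0..T}" for b s
    by (intro has_vector_derivative_diff dX that a)
  have grow: "norm (X s b - X s a) \<le> G * norm (b - a)"
    if b: "b \<in> R" and s: "s \<in> {0..T}"
      and near: "\<And>q. 0 < q \<Longrightarrow> q < s \<Longrightarrow> norm (X q b - X q a) \<le> r" for b s
  proof -
    have "norm (X s b - X s a) \<le> exp (C * s) * norm (X 0 b - X 0 a)"
    proof (rule gronwall_norm)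
      show "((\<lambda>s. X s b - X s a) has_vector_derivative v q (X q b) - v q (X q a)) (at q within {0..s})"
        if "q \<in> {0..s}" for q
        using dE[OF b, of q] that s by (auto intro: has_vector_derivative_within_subset)
      show "norm (v q (X q b) - v q (X q a)) \<le> C * norm (X q b - X q a)" if "0 < q" "q < s" for q
        using near[OF that] that s by (intro lip) auto
    qed (use s in auto)
    also have "\<dots> \<le> G * norm (b - a)"
      using X0 a b s \<open>C \<ge> 0\<close> by (auto simp: G_def intro!: mult_right_mono mult_left_mono)
    finally show ?thesis .
  qed
  \<comment> \<open>If the path of \<open>b\<close> left the tube, \<open>grow\<close> would apply
    up to the first exit time and keep it inside.\<close>
  have confined: "norm (X s b - X s a) < r"
    if b: "b \<in> R" and small: "G * norm (b - a) < r" and s: "s \<in> {0..T}" for b s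
  proof (rule ccontr)
    assume far: "\<not> ?thesis"
    have contE: "continuous_on {0..T} (\<lambda>s. X s b - X s a)"
      using dE[OF b] by (meson continuous_on_eq_continuous_within has_vector_derivative_continuous)
    let ?S = "{0..T} \<inter> (\<lambda>s. norm (X s b - X s a)) -` {r..}"
    have "closed ?S"
      by (intro continuous_closed_preimage continuous_on_norm contE closed_atLeast closed_atLeastAtMost)
    then have "compact ?S"
      by (metis compact_Icc compact_Int_closed inf.absorb2 inf_le1)
    moreover have "?S \<noteq> {}" using far s by auto
    ultimately obtain q where q: "q \<in> ?S" "\<And>p. p \<in> ?S \<Longrightarrow> q \<le> p"
      using compact_attains_inf[of ?S] by blast
    have "norm (X q b - X q a) \<le> G * norm (b - a)"
    proof (rule grow[OF b])
      fix p assume p: "0 < p" "p < q"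
      then have "p \<notin> ?S" using q(2) by (meson not_le)
      then show "norm (X p b - X p a) \<le> r" using p q(1) by auto
    qed (use q in auto)
    then show False using q(1) small by auto
  qed
  have contN: "continuous_on {0..T} N"
    using dN by (meson continuous_on_eq_continuous_within has_vector_derivative_continuous)
  obtain CN where CN: "\<And>s. s \<in> {0..T} \<Longrightarrow> norm (N s) \<le> CN"
    using compact_imp_bounded[OF compact_continuous_image[OF contN compact_Icc]]
    unfolding bounded_iff by blast
  have "CN \<ge> 0" using order_trans[OF norm_ge_zero CN[of 0]] \<open>0 \<le> T\<close> by simp
  show ?thesis
    unfolding has_derivative_at_alt
  proof (intro conjI allI impI blinfun.bounded_linear_right)
    fix e :: real assume "e > 0"
    define Q where "Q = norm M * CN * G * T"
    have "Q \<ge> 0" using \<open>CN \<ge> 0\<close> \<open>G \<ge> 1\<close> \<open>0 \<le> T\<close> by (simp add: Q_def)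
    \<comment> \<open>\<open>Q\<close> collects the factors that the
      linearization error \<open>\<epsilon>\<close> picks up; \<open>+ 1\<close> avoids division by zero.\<close>
    define \<epsilon> where "\<epsilon> = e / (Q + 1)"
    have "\<epsilon> > 0" using \<open>e > 0\<close> \<open>Q \<ge> 0\<close> by (simp add: \<epsilon>_def)
    have "Q * \<epsilon> \<le> e" using \<open>e > 0\<close> \<open>Q \<ge> 0\<close> by (simp add: \<epsilon>_def field_simps)
    obtain \<delta> where "\<delta> > 0" and \<delta>: "\<And>z z'. z \<in> {0..T} \<times> K \<Longrightarrow> z' \<in> {0..T} \<times> K \<Longrightarrow>
        dist z' z < \<delta> \<Longrightarrow> dist (case z' of (t, x) \<Rightarrow> D t x) (case z of (t, x) \<Rightarrow> D t x) < \<epsilon>"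
      using compact_uniformly_continuous[OF contK compK] \<open>\<epsilon> > 0\<close>
      unfolding uniformly_continuous_on_def by metis
    define d where "d = min r \<delta> / G"
    have "d > 0" using \<open>r > 0\<close> \<open>\<delta> > 0\<close> \<open>G \<ge> 1\<close> by (simp add: d_def)
    have "norm (X t b - X t a - M (b - a)) \<le> e * norm (b - a)" if "norm (b - a) < d" for b
    proof -
      have small: "G * norm (b - a) < min r \<delta>"
        using that \<open>G \<ge> 1\<close> by (simp add: d_def field_simps)
      have "norm (b - a) \<le> G * norm (b - a)"
        using \<open>G \<ge> 1\<close> by (simp add: mult_le_cancel_right1)
      then have "b \<in> cball a r" using small by (simp add: dist_norm norm_minus_commute)
      then have b: "b \<in> R" using cball_K[of 0] X0[OF a] \<open>0 \<le> T\<close> \<open>K \<subseteq> R\<close> by auto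
      define E where "E s = X s b - X s a" for s
      have E_less: "norm (E s) < r" if "s \<in> {0..T}" for s
        using confined[OF b _ that] small by (simp add: E_def)
      have E_le: "norm (E s) \<le> G * norm (b - a)" if "s \<in> {0..T}" for s
        using grow[OF b that] E_less that by (simp add: E_def less_imp_le)
      define \<rho> where "\<rho> s = v s (X s b) - v s (X s a) - D s (X s a) (E s)" for s
      have \<rho>_le: "norm (\<rho> s) \<le> G * norm (b - a) * \<epsilon>" if s: "s \<in> {0..T}" for s
      proof -
        have "norm (\<rho> s) \<le> norm (X s b - X s a) * \<epsilon>"
          unfolding \<rho>_def E_def
        proof (rule differentiable_bound_linearization[where S = "ball (X s a) (min r \<delta>)"
                and ?x0.0 = "X s a" and f' = "\<lambda>y. blinfun_apply (D s y)"])
          have "norm (X s b - X s a) < min r \<delta>"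
            using E_le[OF s] small by (simp add: E_def)
          then show "X s a + q *\<^sub>R (X s b - X s a) \<in> ball (X s a) (min r \<delta>)" if "q \<in> {0..1}" for q
            using that by (auto simp: dist_norm intro: order_le_less_trans[OF mult_left_le_one_le])
          show "X s a \<in> ball (X s a) (min r \<delta>)"
            using \<open>r > 0\<close> \<open>\<delta> > 0\<close> by simp
          fix y assume y: "y \<in> ball (X s a) (min r \<delta>)"
          then have "y \<in> K" using cball_K[OF s] by auto
          then show "(v s has_derivative D s y) (at y within ball (X s a) (min r \<delta>))"
            using D[OF s subsetD[OF \<open>K \<subseteq> R\<close>]] has_derivative_at_withinI by blast
          have "X s a \<in> K" using cball_K[OF s] \<open>r > 0\<close> by auto
          have "dist (D s y) (D s (X s a)) < \<epsilon>"
            using \<delta>[of "(s, X s a)" "(s, y)"] \<open>y \<in> K\<close> \<open>X s a \<in> K\<close> s y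
            by (simp add: dist_Pair_Pair dist_commute)
          then show "onorm (blinfun_apply (D s y) - blinfun_apply (D s (X s a))) \<le> \<epsilon>"
            by (simp add: dist_norm norm_blinfun.rep_eq minus_blinfun.rep_eq fun_diff_def)
        qed
        also have "\<dots> \<le> G * norm (b - a) * \<epsilon>"
          using E_le[OF s] \<open>\<epsilon> > 0\<close> by (intro mult_right_mono) (auto simp: E_def)
        finally show ?thesis .
      qed
      define H where "H s = N s (E s)" for s
      have dH: "(H has_vector_derivative N s (\<rho> s)) (at s within {0..T})"
        if s: "s \<in> {0..T}" for s
        using bounded_bilinear.has_vector_derivative[OF bounded_bilinear_blinfun_apply
            dN[OF s] dE[OF b s]]
        by (simp add: H_def[abs_def] E_def \<rho>_def blinfun.bilinear_simps algebra_simps)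
      have "norm (H t - H 0) \<le> CN * (G * norm (b - a) * \<epsilon>) * norm (t - 0)"
      proof (rule differentiable_bound[where S = "{0..T}" and f' = "\<lambda>s h. h *\<^sub>R N s (\<rho> s)"])
        show "(H has_derivative (\<lambda>h. h *\<^sub>R N s (\<rho> s))) (at s within {0..T})" if "s \<in> {0..T}" for s
          using dH[OF that] by (simp add: has_vector_derivative_def)
        fix s assume s: "s \<in> {0..T}"
        have "norm (N s (\<rho> s)) \<le> norm (N s) * norm (\<rho> s)" by (rule norm_blinfun)
        also have "\<dots> \<le> CN * (G * norm (b - a) * \<epsilon>)"
          using CN[OF s] \<rho>_le[OF s] \<open>CN \<ge> 0\<close> by (intro mult_mono) auto
        finally show "onorm (\<lambda>h. h *\<^sub>R N s (\<rho> s)) \<le> CN * (G * norm (b - a) * \<epsilon>)"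
          by (intro onorm_le) (simp add: mult.commute mult_left_mono)
      qed (use t in auto)
      also have "\<dots> \<le> CN * (G * norm (b - a) * \<epsilon>) * T"
        using t \<open>CN \<ge> 0\<close> \<open>G \<ge> 1\<close> \<open>\<epsilon> > 0\<close> by (intro mult_left_mono) auto
      finally have H_le: "norm (H t - H 0) \<le> CN * (G * norm (b - a) * \<epsilon>) * T" .
      have "X t b - X t a - M (b - a) = M (H t - H 0)"
        using X0 a b N0 MN by (simp add: H_def E_def blinfun.diff_right)
      also have "norm \<dots> \<le> norm M * norm (H t - H 0)" by (rule norm_blinfun)
      also have "\<dots> \<le> norm M * (CN * (G * norm (b - a) * \<epsilon>) * T)"
        using H_le by (rule mult_left_mono) simp
      also have "\<dots> = (Q * \<epsilon>) * norm (b - a)" by (simp add: Q_def)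
      also have "\<dots> \<le> e * norm (b - a)"
        using \<open>Q * \<epsilon> \<le> e\<close> by (rule mult_right_mono) simp
      finally show ?thesis .
    qed
    with \<open>d > 0\<close> show "\<exists>d>0. \<forall>y. norm (y - a) < d \<longrightarrow>
        norm (X t y - X t a - M (y - a)) \<le> e * norm (y - a)" by blast
  qed
qed

section \<open>Second derivatives commute\<close>

text \<open>The mean value theorem is applied first in direction \<open>v\<close>, to the increment over \<open>h *\<^sub>R w\<close>, and
  then in direction \<open>w\<close>. The second difference is symmetric in \<open>v\<close> and \<open>w\<close> while the right-hand side
  is not, and this is what makes second derivatives commute.\<close>

lemma second_difference_mean_value:
  fixes g :: "'a::real_normed_vector \<Rightarrow> real"
  assumes "0 < h"
    and U: "\<And>s t. 0 \<le> s \<Longrightarrow> s \<le> h \<Longrightarrow> 0 \<le> t \<Longrightarrow> t \<le> h \<Longrightarrow> z + s *\<^sub>R v + t *\<^sub>R w \<in> U"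
    and g: "\<And>x. x \<in> U \<Longrightarrow> (g has_derivative g' x) (at x)"
    and gv: "\<And>x. x \<in> U \<Longrightarrow> ((\<lambda>x. g' x v) has_derivative gv' x) (at x)"
  obtains \<xi> \<eta> where "0 < \<xi>" "\<xi> < h" "0 < \<eta>" "\<eta> < h"
    and "g (z + h *\<^sub>R v + h *\<^sub>R w) - g (z + h *\<^sub>R v) - g (z + h *\<^sub>R w) + g z =
      h * h * gv' (z + \<xi> *\<^sub>R v + \<eta> *\<^sub>R w) w"
proof -
  have line: "((\<lambda>s. f (c + s *\<^sub>R d)) has_real_derivative f' d) (at s)"
    if "(f has_derivative f') (at (c + s *\<^sub>R d))" for f :: "'a \<Rightarrow> real" and f' c d s
  proof -
    interpret bounded_linear f' using that by (rule has_derivative_bounded_linear)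
    have "((\<lambda>s. c + s *\<^sub>R d) has_derivative (\<lambda>h. h *\<^sub>R d)) (at s)"
      by (auto intro!: derivative_eq_intros)
    from diff_chain_at[OF this that] show ?thesis
      by (simp add: has_field_derivative_def o_def scaleR mult_commute_abs)
  qed
  define \<phi> where "\<phi> s = g ((z + h *\<^sub>R w) + s *\<^sub>R v) - g (z + s *\<^sub>R v)" for s
  define \<phi>' where "\<phi>' s = g' (z + h *\<^sub>R w + s *\<^sub>R v) v - g' (z + s *\<^sub>R v) v" for s
  have "(\<phi> has_real_derivative \<phi>' s) (at s)" if "0 \<le> s" "s \<le> h" for s
    unfolding \<phi>_def \<phi>'_def
  proof (intro DERIV_diff line[OF g])
    show "z + h *\<^sub>R w + s *\<^sub>R v \<in> U" using U[of s h] that \<open>0 < h\<close> by (simp add: add_ac)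
    show "z + s *\<^sub>R v \<in> U" using U[of s 0] that \<open>0 < h\<close> by simp
  qed
  from MVT2[OF \<open>0 < h\<close> this] obtain \<xi>
    where \<xi>: "0 < \<xi>" "\<xi> < h" "\<phi> h - \<phi> 0 = h * \<phi>' \<xi>" by auto
  define \<psi> where "\<psi> t = g' (z + \<xi> *\<^sub>R v + t *\<^sub>R w) v" for t
  have "(\<psi> has_real_derivative gv' (z + \<xi> *\<^sub>R v + t *\<^sub>R w) w) (at t)" if "0 \<le> t" "t \<le> h" for t
    unfolding \<psi>_def by (rule line, rule gv, rule U) (use that \<xi> in auto)
  from MVT2[OF \<open>0 < h\<close> this] obtain \<eta>
    where \<eta>: "0 < \<eta>" "\<eta> < h" "\<psi> h - \<psi> 0 = h * gv' (z + \<xi> *\<^sub>R v + \<eta> *\<^sub>R w) w" by auto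
  have "\<phi>' \<xi> = \<psi> h - \<psi> 0" by (simp add: \<phi>'_def \<psi>_def add_ac)
  then have "\<phi> h - \<phi> 0 = h * h * gv' (z + \<xi> *\<^sub>R v + \<eta> *\<^sub>R w) w"
    using \<xi>(3) \<eta>(3) by simp
  then show ?thesis
    using that[OF \<xi>(1,2) \<eta>(1,2)] by (simp add: \<phi>_def add_ac)
qed

lemma second_derivatives_commute:
  fixes g :: "'a::real_normed_vector \<Rightarrow> real"
  assumes "open U" "z \<in> U"
    and g: "\<And>x. x \<in> U \<Longrightarrow> (g has_derivative g' x) (at x)"
    and gv: "\<And>x. x \<in> U \<Longrightarrow> ((\<lambda>x. g' x v) has_derivative gv' x) (at x)"
    and gw: "\<And>x. x \<in> U \<Longrightarrow> ((\<lambda>x. g' x w) has_derivative gw' x) (at x)"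
    and contv: "isCont (\<lambda>x. gv' x w) z" and contw: "isCont (\<lambda>x. gw' x v) z"
  shows "gv' z w = gw' z v"
proof (rule ccontr)
  assume neq: "gv' z w \<noteq> gw' z v"
  define \<epsilon> where "\<epsilon> = \<bar>gv' z w - gw' z v\<bar> / 2"
  have "\<epsilon> > 0" using neq by (simp add: \<epsilon>_def)
  obtain d1 where d1: "d1 > 0" "\<And>x. dist x z < d1 \<Longrightarrow> \<bar>gv' x w - gv' z w\<bar> < \<epsilon>"
    using contv \<open>\<epsilon> > 0\<close> unfolding continuous_at_eps_delta dist_real_def by metis
  obtain d2 where d2: "d2 > 0" "\<And>x. dist x z < d2 \<Longrightarrow> \<bar>gw' x v - gw' z v\<bar> < \<epsilon>"
    using contw \<open>\<epsilon> > 0\<close> unfolding continuous_at_eps_delta dist_real_def by metis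
  obtain d3 where d3: "d3 > 0" "\<And>x. dist x z < d3 \<Longrightarrow> x \<in> U"
    using \<open>open U\<close> \<open>z \<in> U\<close> unfolding open_dist by metis
  define d where "d = min d1 (min d2 d3)"
  have "d > 0" using d1 d2 d3 by (simp add: d_def)
  define h where "h = d / (norm v + norm w + 1)"
  have "norm v + norm w + 1 > 0" by (smt (verit) norm_ge_zero)
  then have "h > 0" using \<open>d > 0\<close> by (simp add: h_def)
  have "h * (norm v + norm w + 1) = d"
    using \<open>norm v + norm w + 1 > 0\<close> by (simp add: h_def)
  then have hd: "h * norm v + h * norm w < d"
    using \<open>h > 0\<close> by (simp add: algebra_simps)
  have near: "dist (z + s *\<^sub>R v + t *\<^sub>R w) z < d" if "0 \<le> s" "s \<le> h" "0 \<le> t" "t \<le> h" for s t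
  proof -
    have "dist (z + s *\<^sub>R v + t *\<^sub>R w) z = norm (s *\<^sub>R v + t *\<^sub>R w)"
      by (simp add: dist_norm algebra_simps)
    also have "\<dots> \<le> s * norm v + t * norm w"
      using norm_triangle_ineq[of "s *\<^sub>R v" "t *\<^sub>R w"] that by simp
    also have "\<dots> \<le> h * norm v + h * norm w"
      using that by (intro add_mono mult_right_mono) auto
    finally show ?thesis using hd by simp
  qed
  then have near': "dist (z + s *\<^sub>R w + t *\<^sub>R v) z < d" if "0 \<le> s" "s \<le> h" "0 \<le> t" "t \<le> h" for s t
    using near[OF that(3,4,1,2)] by (simp add: add_ac)
  have inU: "z + s *\<^sub>R v + t *\<^sub>R w \<in> U" and inU': "z + s *\<^sub>R w + t *\<^sub>R v \<in> U"
    if "0 \<le> s" "s \<le> h" "0 \<le> t" "t \<le> h" for s t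
    using near[OF that] near'[OF that] d3(2) by (simp_all add: d_def)
  obtain \<xi> \<eta> where 1: "0 < \<xi>" "\<xi> < h" "0 < \<eta>" "\<eta> < h"
    "g (z + h *\<^sub>R v + h *\<^sub>R w) - g (z + h *\<^sub>R v) - g (z + h *\<^sub>R w) + g z =
      h * h * gv' (z + \<xi> *\<^sub>R v + \<eta> *\<^sub>R w) w"
    by (rule second_difference_mean_value[OF \<open>h > 0\<close> inU g gv])
  obtain \<xi>' \<eta>' where 2: "0 < \<xi>'" "\<xi>' < h" "0 < \<eta>'" "\<eta>' < h"
    "g (z + h *\<^sub>R w + h *\<^sub>R v) - g (z + h *\<^sub>R w) - g (z + h *\<^sub>R v) + g z =
      h * h * gw' (z + \<xi>' *\<^sub>R w + \<eta>' *\<^sub>R v) v"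
    by (rule second_difference_mean_value[OF \<open>h > 0\<close> inU' g gw])
  have "g (z + h *\<^sub>R v + h *\<^sub>R w) = g (z + h *\<^sub>R w + h *\<^sub>R v)" by (simp add: add_ac)
  with 1(5) 2(5)
  have "h * h * gv' (z + \<xi> *\<^sub>R v + \<eta> *\<^sub>R w) w = h * h * gw' (z + \<xi>' *\<^sub>R w + \<eta>' *\<^sub>R v) v"
    by linarith
  with \<open>h > 0\<close> have eq: "gv' (z + \<xi> *\<^sub>R v + \<eta> *\<^sub>R w) w = gw' (z + \<xi>' *\<^sub>R w + \<eta>' *\<^sub>R v) v" by simp
  have "\<bar>gv' (z + \<xi> *\<^sub>R v + \<eta> *\<^sub>R w) w - gv' z w\<bar> < \<epsilon>"
    using near[of \<xi> \<eta>] 1 by (intro d1(2)) (simp add: d_def)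
  moreover have "\<bar>gw' (z + \<xi>' *\<^sub>R w + \<eta>' *\<^sub>R v) v - gw' z v\<bar> < \<epsilon>"
    using near'[of \<xi>' \<eta>'] 2 by (intro d2(2)) (simp add: d_def)
  ultimately have "\<bar>gv' z w - gw' z v\<bar> < 2 * \<epsilon>" using eq by linarith
  then show False by (simp add: \<epsilon>_def)
qed

section \<open>Smooth functions and their local extensions\<close>

text \<open>\<^const>\<open>Ck_on\<close> is a statement about one order at a time. Taken for all orders it is
  closed under directional derivatives.\<close>

definition C_inf_on :: "'a::euclidean_space set \<Rightarrow> ('a \<Rightarrow> 'b::euclidean_space) \<Rightarrow> bool" where
  "C_inf_on U g \<longleftrightarrow> (\<forall>k. Ck_on k U g)"

lemma C_inf_on_subset:
  assumes "C_inf_on U g" "V \<subseteq> U"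
  shows "C_inf_on V g"
proof -
  have "Ck_on k U g \<Longrightarrow> Ck_on k V g" for k
    using \<open>V \<subseteq> U\<close> by (induction k arbitrary: g) (auto intro: continuous_on_subset)
  then show ?thesis using assms(1) by (simp add: C_inf_on_def)
qed

lemma C_inf_on_continuous: "C_inf_on U g \<Longrightarrow> continuous_on U g"
  unfolding C_inf_on_def by (metis Ck_on.simps(1))

lemma C_inf_on_has_derivative:
  "C_inf_on U g \<Longrightarrow> x \<in> U \<Longrightarrow> (g has_derivative frechet_derivative g (at x)) (at x)"
  unfolding C_inf_on_def by (metis Ck_on.simps(2) frechet_derivative_works)

lemma C_inf_on_derivative: "C_inf_on U g \<Longrightarrow> C_inf_on U (\<lambda>x. frechet_derivative g (at x) v)"
  unfolding C_inf_on_def by (metis Ck_on.simps(2))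

lemma C_inf_on_derivatives_commute:
  fixes g :: "'a::euclidean_space \<Rightarrow> 'b::euclidean_space"
  assumes g: "C_inf_on U g" and U: "open U" "z \<in> U"
  shows "frechet_derivative (\<lambda>x. frechet_derivative g (at x) v) (at z) w =
    frechet_derivative (\<lambda>x. frechet_derivative g (at x) w) (at z) v"
proof (rule euclidean_eqI)
  fix b :: 'b
  note deriv = C_inf_on_has_derivative[THEN has_derivative_inner_left]
  have cont: "isCont (\<lambda>x. frechet_derivative (\<lambda>y. frechet_derivative g (at y) p) (at x) q \<bullet> b) z"
    for p q
    using C_inf_on_continuous[OF C_inf_on_derivative[OF C_inf_on_derivative[OF g]]] U
    by (auto intro!: continuous_intros simp: continuous_on_eq_continuous_at)
  show "frechet_derivative (\<lambda>x. frechet_derivative g (at x) v) (at z) w \<bullet> b =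
    frechet_derivative (\<lambda>x. frechet_derivative g (at x) w) (at z) v \<bullet> b"
    by (rule second_derivatives_commute[OF U deriv[OF g] deriv[OF C_inf_on_derivative[OF g]]
          deriv[OF C_inf_on_derivative[OF g]] cont cont])
qed

text \<open>Up to the end points of \<open>J\<close> in time, smoothness is that of a local extension. The neighbourhood
  is shrunk so that it lies over the open set \<open>R\<close>: at every time in \<open>J\<close> the extension then agrees with
  \<open>f\<close> on a full spatial neighbourhood, so that spatial derivatives of \<open>f\<close> of all orders, and
  one-sided time derivatives, are derivatives of the extension.\<close>

lemma smooth_on_local_extension:
  fixes f :: "real \<times> 'a::euclidean_space \<Rightarrow> 'b::euclidean_space"
  assumes f: "smooth_on {(t, x). t \<in> J \<and> x \<in> closure R} f"
    and "open R" "t \<in> J" "x \<in> R"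
  obtains V g where "open V" "(t, x) \<in> V" "C_inf_on V g"
    and "\<And>s y. (s, y) \<in> V \<Longrightarrow> y \<in> R"
    and "\<And>s y. (s, y) \<in> V \<Longrightarrow> s \<in> J \<Longrightarrow> g (s, y) = f (s, y)"
proof -
  have "(t, x) \<in> {(t, x). t \<in> J \<and> x \<in> closure R}"
    using assms(3,4) closure_subset by auto
  then obtain U g where U: "open U" "(t, x) \<in> U" "\<forall>k. Ck_on k U g"
      and eq: "\<forall>y\<in>{(t, x). t \<in> J \<and> x \<in> closure R} \<inter> U. g y = f y"
    using f unfolding smooth_on_def by meson
  show ?thesis
  proof (rule that)
    show "open (U \<inter> UNIV \<times> R)" using U(1) \<open>open R\<close> by (intro open_Int open_Times) auto
    show "C_inf_on (U \<inter> UNIV \<times> R) g"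
      by (rule C_inf_on_subset[of U]) (use U(3) in \<open>auto simp: C_inf_on_def\<close>)
    show "g (s, y) = f (s, y)" if "(s, y) \<in> U \<inter> UNIV \<times> R" "s \<in> J" for s y
      using eq that closure_subset[of R] by blast
  qed (use U(2) \<open>x \<in> R\<close> in auto)
qed

lemma C_inf_on_space_derivative:
  assumes g: "C_inf_on V g" and V: "open V" "(t, x) \<in> V"
    and eq: "\<And>y. (t, y) \<in> V \<Longrightarrow> g (t, y) = f y"
  shows "(f has_derivative (\<lambda>h. frechet_derivative g (at (t, x)) (0, h))) (at x)"
proof -
  have "((\<lambda>y. (t, y)) has_derivative (\<lambda>h. (0, h))) (at x)"
    by (auto intro!: derivative_eq_intros)
  from diff_chain_at[OF this C_inf_on_has_derivative[OF g V(2)]]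
  have "((\<lambda>y. g (t, y)) has_derivative (\<lambda>h. frechet_derivative g (at (t, x)) (0, h))) (at x)"
    by (simp add: o_def)
  moreover have "open (Pair t -` V)"
    using V(1) by (rule open_vimage) (auto intro!: continuous_intros)
  ultimately show ?thesis
    by (rule has_derivative_transform_within_open) (use V eq in auto)
qed

lemma C_inf_on_path_derivative:
  fixes \<gamma> :: "real \<Rightarrow> 'a::euclidean_space"
  assumes g: "C_inf_on V g" and V: "open V" "(t, \<gamma> t) \<in> V"
    and \<gamma>: "(\<gamma> has_vector_derivative \<gamma>') (at t within J)" and "t \<in> J"
    and eq: "\<And>s. (s, \<gamma> s) \<in> V \<Longrightarrow> s \<in> J \<Longrightarrow> g (s, \<gamma> s) = f s"
  shows "(f has_vector_derivative frechet_derivative g (at (t, \<gamma> t)) (1, \<gamma>')) (at t within J)"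
proof -
  have path: "((\<lambda>s. (s, \<gamma> s)) has_vector_derivative (1, \<gamma>')) (at t within J)"
    by (intro has_vector_derivative_Pair \<gamma>) auto
  have dg: "((\<lambda>s. g (s, \<gamma> s)) has_vector_derivative
      frechet_derivative g (at (t, \<gamma> t)) (1, \<gamma>')) (at t within J)"
    using vector_derivative_diff_chain_within[OF path
        has_derivative_at_withinI[OF C_inf_on_has_derivative[OF g V(2)]]]
    by (simp add: o_def)
  have "continuous (at t within J) (\<lambda>s. (s, \<gamma> s))"
    using path by (rule has_vector_derivative_continuous)
  then have "\<forall>\<^sub>F s in at t within J. (s, \<gamma> s) \<in> V"
    using V unfolding continuous_within by (intro topological_tendstoD)
  then obtain d where "d > 0" and d: "\<And>s. s \<in> J \<Longrightarrow> s \<noteq> t \<Longrightarrow> dist s t < d \<Longrightarrow> (s, \<gamma> s) \<in> V"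
    unfolding eventually_at by auto
  show ?thesis
  proof (rule has_vector_derivative_transform_within[OF dg \<open>d > 0\<close> \<open>t \<in> J\<close>])
    show "g (s, \<gamma> s) = f s" if "s \<in> J" "dist s t < d" for s
      using eq[of s] V(2) d[of s] that by (cases "s = t") auto
  qed
qed

section \<open>Transport of the absolute vorticity\<close>

lemma bounded_linear_cross3_right: "bounded_linear (cross3 c)"
  using bilinear_cross unfolding bilinear_conv_bounded_bilinear
  by (rule bounded_bilinear.bounded_linear_right)

lemma partial_component:
  assumes "(v has_derivative v') (at x)"
  shows "partial j (\<lambda>y. v y $ i) x = v' (axis j 1) $ i"
proof -
  have "((\<lambda>y. v y $ i) has_derivative (\<lambda>h. v' h $ i)) (at x)"
    by (rule bounded_linear.has_derivative[OF bounded_linear_vec_nth assms])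
  from frechet_derivative_at[OF this] show ?thesis
    unfolding partial_def by metis
qed

text \<open>The formula \<open>\<nabla> \<times> v = \<Sum>\<^sub>i e\<^sub>i \<times> \<partial>\<^sub>i v\<close>: the curl is a fixed linear function of the
  gradient, so that its evolution follows from that of the gradient.\<close>

lemma curl_eq_sum_cross3:
  assumes "(v has_derivative v') (at x)"
  shows "curl v x = (\<Sum>i\<in>UNIV. cross3 (axis i 1) (v' (axis i 1)))"
  unfolding curl_def partial_component[OF assms]
  by (simp add: vec_eq_iff forall_3 sum_3 cross3_def axis_def)

locale rotating_flow =
  fixes R :: "(real^3) set" and n :: "real^3 \<Rightarrow> real^3" and \<Omega> T :: real
    and u :: "real \<Rightarrow> real^3 \<Rightarrow> real^3" and p :: "real \<Rightarrow> real^3 \<Rightarrow> real"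
    and X :: "real \<Rightarrow> real^3 \<Rightarrow> real^3"
  assumes T_pos: "T > 0"
    and open_R: "open R"
    and euler: "rotating_euler_solution \<Omega> R n T u p"
    and flow: "lagrangian_map R T u X"
begin

lemma X_0: "a \<in> R \<Longrightarrow> X 0 a = a"
  and X_in_R: "t \<in> {0..T} \<Longrightarrow> a \<in> R \<Longrightarrow> X t a \<in> R"
  and X_has_vector_derivative: "t \<in> {0..T} \<Longrightarrow> a \<in> R \<Longrightarrow>
    ((\<lambda>s. X s a) has_vector_derivative u t (X t a)) (at t within {0..T})"
  using flow by (auto simp: lagrangian_map_def)

lemma velocity_extension:
  assumes "t \<in> {0..T}" "x \<in> R"
  obtains V g where "open V" "(t, x) \<in> V" "C_inf_on V g"
    and "\<And>s y. (s, y) \<in> V \<Longrightarrow> y \<in> R"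
    and "\<And>s y. (s, y) \<in> V \<Longrightarrow> s \<in> {0..T} \<Longrightarrow> g (s, y) = u s y"
proof -
  have "smooth_on {(t, x). t \<in> {0..T} \<and> x \<in> closure R} (\<lambda>(t, x). u t x)"
    using euler unfolding rotating_euler_solution_def by blast
  then show ?thesis
    by (rule smooth_on_local_extension[OF _ open_R assms]) (rule that; simp)
qed

lemma pressure_extension:
  assumes "t \<in> {0..T}" "x \<in> R"
  obtains V q where "open V" "(t, x) \<in> V" "C_inf_on V q"
    and "\<And>s y. (s, y) \<in> V \<Longrightarrow> s \<in> {0..T} \<Longrightarrow> q (s, y) = p s y"
proof -
  have "smooth_on {(t, x). t \<in> {0..T} \<and> x \<in> closure R} (\<lambda>(t, x). p t x)"
    using euler unfolding rotating_euler_solution_def by blast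
  then show ?thesis
    by (rule smooth_on_local_extension[OF _ open_R assms]) (rule that; simp)
qed

lemma velocity_has_derivative:
  assumes "t \<in> {0..T}" "x \<in> R"
  shows "(u t has_derivative frechet_derivative (u t) (at x)) (at x)"
proof -
  obtain V g where "open V" "(t, x) \<in> V" "C_inf_on V g"
    "\<And>s y. (s, y) \<in> V \<Longrightarrow> s \<in> {0..T} \<Longrightarrow> g (s, y) = u s y"
    using velocity_extension[OF assms] by metis
  then show ?thesis
    using C_inf_on_space_derivative[of V g t x "u t"] frechet_derivative_at assms(1) by metis
qed

lemma continuous_on_velocity_gradient:
  "continuous_on ({0..T} \<times> R) (\<lambda>(t, x). frechet_derivative (u t) (at x) h)"
  unfolding continuous_on_eq_continuous_within
proof
  fix z assume z: "z \<in> {0..T} \<times> R"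
  obtain t x where tx: "z = (t, x)" "t \<in> {0..T}" "x \<in> R" using z by auto
  obtain V g where V: "open V" "z \<in> V" and g: "C_inf_on V g"
    and eq: "\<And>s y. (s, y) \<in> V \<Longrightarrow> s \<in> {0..T} \<Longrightarrow> g (s, y) = u s y"
    using velocity_extension[OF tx(2,3)] unfolding tx(1) by metis
  obtain d where d: "d > 0" "\<And>z'. dist z' z < d \<Longrightarrow> z' \<in> V"
    using V unfolding open_dist by metis
  have "isCont (\<lambda>z. frechet_derivative g (at z) (0, h)) z"
    using C_inf_on_continuous[OF C_inf_on_derivative[OF g]] V
    by (auto simp: continuous_on_eq_continuous_at)
  then have "continuous (at z within {0..T} \<times> R) (\<lambda>z. frechet_derivative g (at z) (0, h))"
    by (rule continuous_at_imp_continuous_at_within)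
  then show "continuous (at z within {0..T} \<times> R) (\<lambda>(t, x). frechet_derivative (u t) (at x) h)"
  proof (rule continuous_transform_within[OF _ d(1) z])
    fix z' assume z': "z' \<in> {0..T} \<times> R" "dist z' z < d"
    obtain s y where sy: "z' = (s, y)" "s \<in> {0..T}" using z' by auto
    have "(u s has_derivative (\<lambda>h. frechet_derivative g (at (s, y)) (0, h))) (at y)"
      using d(2)[OF z'(2)] sy by (intro C_inf_on_space_derivative[OF g V(1)] eq) auto
    then show "frechet_derivative g (at z') (0, h) =
        (case z' of (t, x) \<Rightarrow> frechet_derivative (u t) (at x) h)"
      using frechet_derivative_at[of "u s" _ y] by (simp add: sy(1))
  qed
qed

text \<open>Differentiating the momentum equation in the direction \<open>i\<close> gives the Riccati equation of the
  columns \<open>\<beta> i = \<partial>\<^sub>i u\<close> of the velocity gradient along a particle path; \<open>H\<close> is the Hessian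
  of the pressure. The interchange of \<open>\<partial>\<^sub>i\<close> with the time derivative and with the advecting
  derivatives is made for the smooth extension of \<open>u\<close>, where derivatives commute even at the end
  points \<open>0\<close> and \<open>T\<close>.\<close>

lemma velocity_gradient_evolution:
  assumes t: "t \<in> {0..T}" and a: "a \<in> R"
  defines "\<beta> \<equiv> \<lambda>i s. frechet_derivative (u s) (at (X s a)) (axis i 1)"
  obtains H :: "real^3^3" where "\<And>i j. H $ i $ j = H $ j $ i"
    and "\<And>i. (\<beta> i has_vector_derivative
      - (\<Sum>j\<in>UNIV. (\<beta> i t $ j) *\<^sub>R \<beta> j t) - H $ i - (2 * \<Omega>) *\<^sub>R cross3 e3 (\<beta> i t))
      (at t within {0..T})"
proof -
  define x where "x = X t a"
  have x: "x \<in> R" using X_in_R[OF t a] by (simp add: x_def)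
  obtain Vg g where g: "open Vg" "(t, x) \<in> Vg" "C_inf_on Vg g" and g_R: "\<And>s y. (s, y) \<in> Vg \<Longrightarrow> y \<in> R"
    and g_eq: "\<And>s y. (s, y) \<in> Vg \<Longrightarrow> s \<in> {0..T} \<Longrightarrow> g (s, y) = u s y"
    using velocity_extension[OF t x] by metis
  obtain Vq q where q: "open Vq" "(t, x) \<in> Vq" "C_inf_on Vq q"
    and q_eq: "\<And>s y. (s, y) \<in> Vq \<Longrightarrow> s \<in> {0..T} \<Longrightarrow> q (s, y) = p s y"
    using pressure_extension[OF t x] by metis
  define V where "V = Vg \<inter> Vq"
  have V: "open V" "(t, x) \<in> V" using g(1,2) q(1,2) by (auto simp: V_def)
  have Cg: "C_inf_on V g" using g(3) by (rule C_inf_on_subset) (simp add: V_def)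
  have Cq: "C_inf_on V q" using q(3) by (rule C_inf_on_subset) (simp add: V_def)
  define e :: "3 \<Rightarrow> real \<times> (real^3)" where "e j = (0, axis j 1)" for j
  define G0 where "G0 z = frechet_derivative g (at z) (1, 0)" for z
  define G where "G j z = frechet_derivative g (at z) (e j)" for j z
  define q' where "q' j z = frechet_derivative q (at z) (e j)" for j z
  have CG0: "C_inf_on V G0" and CG: "C_inf_on V (G j)" and Cq': "C_inf_on V (q' j)" for j
    unfolding G0_def[abs_def] G_def[abs_def] q'_def[abs_def]
    by (intro C_inf_on_derivative Cg Cq)+
  have space_u: "(u s has_derivative (\<lambda>h. frechet_derivative g (at (s, y)) (0, h))) (at y)"
    if "(s, y) \<in> V" "s \<in> {0..T}" for s y
    by (rule C_inf_on_space_derivative[OF Cg V(1) that(1)]) (use that g_eq in \<open>auto simp: V_def\<close>)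
  have partial_u: "frechet_derivative (u s) (at y) (axis j 1) = G j (s, y)"
    if "(s, y) \<in> V" "s \<in> {0..T}" for s y j
    using frechet_derivative_at[OF space_u[OF that]] by (simp add: G_def e_def) metis
  have grad_p: "grad (p t) y = (\<Sum>j\<in>UNIV. q' j (t, y) *\<^sub>R axis j 1)" if "(t, y) \<in> V" for y
  proof -
    have "(p t has_derivative (\<lambda>h. frechet_derivative q (at (t, y)) (0, h))) (at y)"
      by (rule C_inf_on_space_derivative[OF Cq V(1) that]) (use t q_eq in \<open>auto simp: V_def\<close>)
    from frechet_derivative_at[OF this]
    have "partial j (p t) y = q' j (t, y)" for j
      unfolding partial_def by (simp add: q'_def e_def) metis
    then show ?thesis
      by (simp add: grad_def vec_eq_iff axis_def if_distrib cong: if_cong)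
  qed
  \<comment> \<open>The momentum equation at the fixed time \<open>t\<close>, in terms of
    the extensions. It holds for all \<open>y\<close> near \<open>x\<close> and may thus be differentiated in space.\<close>
  have momentum: "G0 (t, y) + (\<Sum>j\<in>UNIV. (g (t, y) $ j) *\<^sub>R G j (t, y)) +
      (\<Sum>j\<in>UNIV. q' j (t, y) *\<^sub>R axis j 1) + (2 * \<Omega>) *\<^sub>R cross3 e3 (g (t, y)) = 0"
    if y: "(t, y) \<in> V" for y
  proof -
    have "y \<in> R" using g_R y by (auto simp: V_def)
    have "((\<lambda>s. u s y) has_vector_derivative frechet_derivative g (at (t, y)) (1, 0))
        (at t within {0..T})"
      by (rule C_inf_on_path_derivative[OF Cg V(1) y _ t])
        (use g_eq in \<open>auto simp: V_def\<close>)
    then have "vector_derivative (\<lambda>s. u s y) (at t within {0..T}) = G0 (t, y)"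
      using vector_derivative_within_closed_interval[OF T_pos t] by (simp add: G0_def)
    moreover have "advection (u t) (u t) y = (\<Sum>j\<in>UNIV. (g (t, y) $ j) *\<^sub>R G j (t, y))"
      using y g_eq t by (simp add: advection_def partial_def partial_u V_def)
    moreover have "u t y = g (t, y)" using g_eq y t by (simp add: V_def)
    moreover have "vector_derivative (\<lambda>s. u s y) (at t within {0..T}) + advection (u t) (u t) y +
        grad (p t) y + (2 * \<Omega>) *\<^sub>R cross3 e3 (u t y) = 0"
      using euler t \<open>y \<in> R\<close> unfolding rotating_euler_solution_def by blast
    ultimately show ?thesis
      by (simp only: grad_p[OF y])
  qed
  have slice: "((\<lambda>y. f (t, y)) has_derivative (\<lambda>h. frechet_derivative f (at (t, x)) (0, h))) (at x)"
    if "C_inf_on V f" for f :: "real \<times> (real^3) \<Rightarrow> 'c::euclidean_space"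
    by (rule C_inf_on_space_derivative[OF that V]) simp
  \<comment> \<open>Its derivative in the direction \<open>axis i 1\<close> at \<open>x\<close>.\<close>
  have momentum': "frechet_derivative G0 (at (t, x)) (e i) +
      (\<Sum>j\<in>UNIV. (g (t, x) $ j) *\<^sub>R frechet_derivative (G j) (at (t, x)) (e i) + (G i (t, x) $ j) *\<^sub>R G j (t, x)) +
      (\<Sum>j\<in>UNIV. frechet_derivative (q' j) (at (t, x)) (e i) *\<^sub>R axis j 1) +
      (2 * \<Omega>) *\<^sub>R cross3 e3 (G i (t, x)) = 0" for i
  proof -
    let ?F = "\<lambda>y. G0 (t, y) + (\<Sum>j\<in>UNIV. (g (t, y) $ j) *\<^sub>R G j (t, y)) +
      (\<Sum>j\<in>UNIV. q' j (t, y) *\<^sub>R axis j 1) + (2 * \<Omega>) *\<^sub>R cross3 e3 (g (t, y))"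
    let ?F' = "\<lambda>h. frechet_derivative G0 (at (t, x)) (0, h) +
      (\<Sum>j\<in>UNIV. (g (t, x) $ j) *\<^sub>R frechet_derivative (G j) (at (t, x)) (0, h) +
        (frechet_derivative g (at (t, x)) (0, h) $ j) *\<^sub>R G j (t, x)) +
      (\<Sum>j\<in>UNIV. frechet_derivative (q' j) (at (t, x)) (0, h) *\<^sub>R axis j 1) +
      (2 * \<Omega>) *\<^sub>R cross3 e3 (frechet_derivative g (at (t, x)) (0, h))"
    have "(?F has_derivative ?F') (at x)"
      by (intro has_derivative_add has_derivative_sum has_derivative_scaleR has_derivative_scaleR_left
          has_derivative_scaleR_right slice CG0 CG Cq' Cg
          bounded_linear.has_derivative[OF bounded_linear_vec_nth]
          bounded_linear.has_derivative[OF bounded_linear_cross3_right])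
    moreover have "open (Pair t -` V)"
      using V(1) by (rule open_vimage) (auto intro!: continuous_intros)
    then have "(?F has_derivative (\<lambda>_. 0)) (at x)"
      by (rule has_derivative_transform_within_open[OF has_derivative_const[of 0]])
        (use V(2) momentum in auto)
    ultimately have "?F' = (\<lambda>_. 0)" by (rule has_derivative_unique)
    from fun_cong[OF this, of "axis i 1"] show ?thesis
      by (simp add: e_def G_def)
  qed
  define H :: "real^3^3" where "H = (\<chi> i j. frechet_derivative (q' j) (at (t, x)) (e i))"
  have H_row: "(\<Sum>j\<in>UNIV. frechet_derivative (q' j) (at (t, x)) (e i) *\<^sub>R axis j 1) = H $ i" for i
    by (simp add: H_def vec_eq_iff axis_def if_distrib cong: if_cong)
  have \<beta>_t: "\<beta> i t = G i (t, x)" for i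
    using partial_u[OF V(2) t] by (simp add: \<beta>_def x_def)
  show ?thesis
  proof (rule that)
    show "H $ i $ j = H $ j $ i" for i j
      unfolding H_def q'_def[abs_def] using C_inf_on_derivatives_commute[OF Cq V, of "e j" "e i"] by simp
    fix i
    have "(\<beta> i has_vector_derivative frechet_derivative (G i) (at (t, x)) (1, u t x)) (at t within {0..T})"
      unfolding x_def
      by (rule C_inf_on_path_derivative[OF CG V(1) _ X_has_vector_derivative[OF t a] t])
        (use V(2) partial_u in \<open>auto simp: x_def \<beta>_def\<close>)
    moreover have "frechet_derivative (G i) (at (t, x)) (1, u t x) =
        - (\<Sum>j\<in>UNIV. (\<beta> i t $ j) *\<^sub>R \<beta> j t) - H $ i - (2 * \<Omega>) *\<^sub>R cross3 e3 (\<beta> i t)"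
    proof -
      interpret L: bounded_linear "frechet_derivative (G i) (at (t, x))"
        by (rule has_derivative_bounded_linear[OF C_inf_on_has_derivative[OF CG V(2)]])
      have swap: "frechet_derivative (G i) (at (t, x)) (e j) =
          frechet_derivative (G j) (at (t, x)) (e i)" for j
        unfolding G_def[abs_def] by (rule C_inf_on_derivatives_commute[OF Cg V])
      have "(1, u t x) = (1, 0) + (\<Sum>j\<in>UNIV. (g (t, x) $ j) *\<^sub>R e j)"
        using g_eq V(2) t
        by (simp add: e_def prod_eq_iff fst_sum snd_sum V_def vec_eq_iff axis_def if_distrib cong: if_cong)
      then have "frechet_derivative (G i) (at (t, x)) (1, u t x) =
          frechet_derivative (G i) (at (t, x)) (1, 0) +
          (\<Sum>j\<in>UNIV. (g (t, x) $ j) *\<^sub>R frechet_derivative (G i) (at (t, x)) (e j))"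
        by (simp add: L.add L.sum L.scaleR)
      also have "frechet_derivative (G i) (at (t, x)) (1, 0) = frechet_derivative G0 (at (t, x)) (e i)"
        unfolding G_def[abs_def] G0_def[abs_def] by (rule C_inf_on_derivatives_commute[OF Cg V])
      finally show ?thesis
        using momentum'[of i] unfolding H_row \<beta>_t sum.distrib swap
        by (simp add: algebra_simps eq_neg_iff_add_eq_0)
    qed
    ultimately show "(\<beta> i has_vector_derivative
      - (\<Sum>j\<in>UNIV. (\<beta> i t $ j) *\<^sub>R \<beta> j t) - H $ i - (2 * \<Omega>) *\<^sub>R cross3 e3 (\<beta> i t))
      (at t within {0..T})" by simp
  qed
qed

text \<open>The curl of the Riccati equation: the symmetric Hessian drops out, incompressibility turns the
  quadratic terms into vortex stretching \<open>\<omega> \<cdot> \<nabla>u\<close>, and the Coriolis term becomes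
  \<open>2 \<Omega> \<partial>\<^sub>3 u\<close>, the stretching of the constant planetary vorticity \<open>2 \<Omega> e\<^sub>3\<close>. The
  absolute vorticity \<open>W\<close> therefore solves the same linear equation along the path as the
  gradient of the flow map.\<close>

lemma absolute_vorticity_evolution:
  assumes t: "t \<in> {0..T}" and a: "a \<in> R"
  defines "W \<equiv> \<lambda>s. curl (u s) (X s a) + (2 * \<Omega>) *\<^sub>R e3"
  shows "(W has_vector_derivative frechet_derivative (u t) (at (X t a)) (W t)) (at t within {0..T})"
proof -
  define \<beta> where "\<beta> i s = frechet_derivative (u s) (at (X s a)) (axis i 1)" for i s
  obtain H :: "real^3^3" where sym: "\<And>i j. H $ i $ j = H $ j $ i"
    and d\<beta>: "\<And>i. (\<beta> i has_vector_derivative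
      - (\<Sum>j\<in>UNIV. (\<beta> i t $ j) *\<^sub>R \<beta> j t) - H $ i - (2 * \<Omega>) *\<^sub>R cross3 e3 (\<beta> i t))
      (at t within {0..T})"
    using velocity_gradient_evolution[OF t a, folded \<beta>_def] by blast
  have du: "(u s has_derivative frechet_derivative (u s) (at (X s a))) (at (X s a))"
    if "s \<in> {0..T}" for s
    using velocity_has_derivative that X_in_R a by blast
  have W_eq: "W s = (\<Sum>i\<in>UNIV. cross3 (axis i 1) (\<beta> i s)) + (2 * \<Omega>) *\<^sub>R e3" if "s \<in> {0..T}" for s
    unfolding W_def curl_eq_sum_cross3[OF du[OF that]] \<beta>_def ..
  have trace: "\<beta> 1 t $ 1 + \<beta> 2 t $ 2 + \<beta> 3 t $ 3 = 0"
  proof -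
    have "divergence (u t) (X t a) = 0"
      using euler t X_in_R[OF t a] unfolding rotating_euler_solution_def by blast
    then show ?thesis
      unfolding divergence_def partial_component[OF du[OF t]] by (simp add: sum_3 \<beta>_def)
  qed
  interpret L: bounded_linear "frechet_derivative (u t) (at (X t a))"
    by (rule has_derivative_bounded_linear[OF du[OF t]])
  have apply_W: "frechet_derivative (u t) (at (X t a)) w = (\<Sum>j\<in>UNIV. (w $ j) *\<^sub>R \<beta> j t)" for w
  proof -
    have "w = (\<Sum>j\<in>UNIV. (w $ j) *\<^sub>R axis j 1)"
      by (simp add: vec_eq_iff axis_def if_distrib cong: if_cong)
    then have "frechet_derivative (u t) (at (X t a)) w =
        frechet_derivative (u t) (at (X t a)) (\<Sum>j\<in>UNIV. (w $ j) *\<^sub>R axis j 1)" by simp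
    then show ?thesis by (simp add: L.sum L.scaleR \<beta>_def)
  qed
  have "((\<lambda>s. (\<Sum>i\<in>UNIV. cross3 (axis i 1) (\<beta> i s)) + (2 * \<Omega>) *\<^sub>R e3) has_vector_derivative
      (\<Sum>i\<in>UNIV. cross3 (axis i 1)
        (- (\<Sum>j\<in>UNIV. (\<beta> i t $ j) *\<^sub>R \<beta> j t) - H $ i - (2 * \<Omega>) *\<^sub>R cross3 e3 (\<beta> i t))) + 0)
      (at t within {0..T})"
    by (intro has_vector_derivative_add has_vector_derivative_sum has_vector_derivative_const
        bounded_linear.has_vector_derivative[OF bounded_linear_cross3_right] d\<beta>)
  then have "(W has_vector_derivative (\<Sum>i\<in>UNIV. cross3 (axis i 1)
        (- (\<Sum>j\<in>UNIV. (\<beta> i t $ j) *\<^sub>R \<beta> j t) - H $ i - (2 * \<Omega>) *\<^sub>R cross3 e3 (\<beta> i t))) + 0)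
      (at t within {0..T})"
    by (rule has_vector_derivative_transform[OF t, rotated]) (simp add: W_eq)
  moreover have "(\<Sum>i\<in>UNIV. cross3 (axis i 1)
        (- (\<Sum>j\<in>UNIV. (\<beta> i t $ j) *\<^sub>R \<beta> j t) - H $ i - (2 * \<Omega>) *\<^sub>R cross3 e3 (\<beta> i t))) + 0 =
      (\<Sum>j\<in>UNIV. (W t $ j) *\<^sub>R \<beta> j t)"
  proof -
    have diag: "\<beta> 1 t $ 1 = - \<beta> 2 t $ 2 - \<beta> 3 t $ 3" using trace by simp
    show ?thesis
      unfolding W_eq[OF t]
      using sym[of 1 2] sym[of 1 3] sym[of 2 3]
      by (simp add: vec_eq_iff forall_3 sum_3 cross3_def axis_def diag) (simp add: algebra_simps)
  qed
  ultimately show ?thesis by (simp add: apply_W)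
qed

text \<open>Cauchy's formula: the flow map carries the absolute vorticity along, because \<open>N W\<close> is constant in
  time.\<close>

lemma flow_gradient:
  assumes t: "t \<in> {0..T}" and a: "a \<in> R"
  obtains M N :: "(real^3) \<Rightarrow>\<^sub>L (real^3)"
  where "(X t has_derivative M) (at a)"
    and "\<And>v. M (N v) = v" and "\<And>v. N (M v) = v"
    and "curl (u t) (X t a) + (2 * \<Omega>) *\<^sub>R e3 = M (curl (u 0) a + (2 * \<Omega>) *\<^sub>R e3)"
proof -
  define D where "D s x = Blinfun (frechet_derivative (u s) (at x))" for s x
  have D: "blinfun_apply (D s x) = frechet_derivative (u s) (at x)" if "s \<in> {0..T}" "x \<in> R" for s x
    unfolding D_def using has_derivative_bounded_linear[OF velocity_has_derivative[OF that]]
    by (rule bounded_linear_Blinfun_apply)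
  have contD: "continuous_on ({0..T} \<times> R) (\<lambda>(s, x). D s x)"
  proof -
    have "continuous_on ({0..T} \<times> R)
        (\<lambda>z. blinfun_of_matrix (\<lambda>i j. (case z of (s, x) \<Rightarrow> frechet_derivative (u s) (at x) j) \<bullet> i))"
      by (intro continuous_on_blinfun_of_matrix continuous_on_inner continuous_on_const
          continuous_on_velocity_gradient)
    then show ?thesis
      by (rule continuous_on_eq) (auto simp: blinfun_of_matrix_works simp flip: D)
  qed
  have contX: "continuous_on {0..T} (\<lambda>s. X s a)"
    using X_has_vector_derivative[OF _ a]
    by (meson continuous_on_eq_continuous_within has_vector_derivative_continuous)
  have contB: "continuous_on {0..T} (\<lambda>s. D s (X s a))"
    using continuous_on_compose2[OF contD, of "{0..T}" "\<lambda>s. (s, X s a)"] X_in_R a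
    by (force intro!: continuous_intros contX)
  obtain M N where "N 0 = id_blinfun"
    and dN: "\<And>s. s \<in> {0..T} \<Longrightarrow>
      (N has_vector_derivative - (N s o\<^sub>L D s (X s a))) (at s within {0..T})"
    and MN: "\<And>s v. s \<in> {0..T} \<Longrightarrow> blinfun_apply (M s) (N s v) = v"
    and NM: "\<And>s v. s \<in> {0..T} \<Longrightarrow> blinfun_apply (N s) (M s v) = v"
    using fundamental_solution[OF less_imp_le[OF T_pos] contB] by metis
  have "(X t has_derivative M t) (at a)"
  proof (rule flow_has_derivative[OF open_R _ contD X_0 X_in_R X_has_vector_derivative a
        \<open>N 0 = id_blinfun\<close> dN MN[OF t] t])
    show "(u s has_derivative D s x) (at x)" if "s \<in> {0..T}" "x \<in> R" for s x
      using velocity_has_derivative[OF that] by (simp add: D[OF that])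
  qed
  moreover have "M t (N t v) = v" "N t (M t v) = v" for v by (rule MN[OF t] NM[OF t])+
  moreover
  define W where "W s = curl (u s) (X s a) + (2 * \<Omega>) *\<^sub>R e3" for s
  have dNW: "((\<lambda>s. N s (W s)) has_vector_derivative 0) (at s within {0..T})" if s: "s \<in> {0..T}" for s
    using bounded_bilinear.has_vector_derivative[OF bounded_bilinear_blinfun_apply dN[OF s]
        absolute_vorticity_evolution[OF s a]]
    by (simp add: W_def[abs_def] D[OF s X_in_R[OF s a]] blinfun.minus_left)
  obtain c where "\<And>s. s \<in> {0..T} \<Longrightarrow> N s (W s) = c"
    using has_vector_derivative_zero_constant[OF _ dNW] by auto
  then have "N t (W t) = N 0 (W 0)" using t T_pos by simp
  then have "N t (W t) = W 0" by (simp add: \<open>N 0 = id_blinfun\<close>)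
  then have "W t = M t (W 0)" using MN[OF t, of "W t"] by simp
  then have "curl (u t) (X t a) + (2 * \<Omega>) *\<^sub>R e3 = M t (curl (u 0) a + (2 * \<Omega>) *\<^sub>R e3)"
    using X_0[OF a] by (simp add: W_def)
  ultimately show ?thesis by (rule that)
qed

end

section \<open>Essential suprema and measurability\<close>

text \<open>A continuous function on an open set cannot exceed its essential supremum: it would do so on a
  nonempty open set, which is not negligible.\<close>

lemma norm_le_Linf_norm:
  assumes "open R" "continuous_on R f" "x \<in> R"
  shows "ennreal (norm (f x)) \<le> Linf_norm R f"
proof (rule ccontr)
  let ?S = "{y \<in> R. Linf_norm R f < ennreal (norm (f y))}"
  assume "\<not> ?thesis"
  then have "x \<in> ?S" using \<open>x \<in> R\<close> by auto
  have cont: "continuous_on R (\<lambda>y. ennreal (norm (f y)))"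
    by (intro continuous_on_ennreal continuous_on_norm assms(2))
  have "open (R \<inter> (\<lambda>y. ennreal (norm (f y))) -` {Linf_norm R f<..})"
    by (intro continuous_open_preimage cont \<open>open R\<close> open_greaterThan)
  moreover have "R \<inter> (\<lambda>y. ennreal (norm (f y))) -` {Linf_norm R f<..} = ?S" by auto
  ultimately have "open ?S" by simp
  have "AE y in lebesgue_on R. ennreal (norm (f y)) \<le> Linf_norm R f"
    unfolding Linf_norm_def by (rule esssup_AE)
  then have "AE y in lebesgue. y \<notin> ?S"
    using \<open>open R\<close> by (subst (asm) AE_restrict_space_iff) (auto elim!: eventually_mono)
  then have "negligible ?S"
    using \<open>open ?S\<close> AE_iff_null_sets[of ?S lebesgue] by (auto simp: negligible_iff_null_sets)
  then show False
    using open_not_negligible[OF \<open>open ?S\<close>] \<open>x \<in> ?S\<close> by blast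
qed

lemma Linf_norm_le:
  assumes "f \<in> borel_measurable (lebesgue_on R)" "\<And>x. x \<in> R \<Longrightarrow> norm (f x) \<le> c"
  shows "Linf_norm R f \<le> ennreal c"
  unfolding Linf_norm_def
proof (rule esssup_I)
  show "AE x in lebesgue_on R. ennreal (norm (f x)) \<le> ennreal c"
    using assms(2) by (intro AE_I2) (auto simp: ennreal_leI)
qed (use assms(1) in measurable)

text \<open>The essential supremum of a nonmeasurable function is infinite, so an upper bound for the norm of
  a partial derivative has to begin with measurability.\<close>

lemma borel_measurable_partial:
  fixes f :: "real^3 \<Rightarrow> real^3"
  assumes "open R" and f: "\<And>x. x \<in> R \<Longrightarrow> (f has_derivative f' x) (at x)"
  shows "partial j f \<in> borel_measurable (lebesgue_on R)"
proof -
  have "(\<lambda>x. matrix (f' x) $ i $ j) \<in> borel_measurable (lebesgue_on R)" for i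
  proof (rule borel_measurable_partial_derivatives)
    show "R \<in> sets lebesgue" using borel_open[OF \<open>open R\<close>] by (simp add: sets_completionI_sets)
    show "(f has_derivative f' x) (at x within R)" if "x \<in> R" for x
      using f[OF that] by (rule has_derivative_at_withinI)
  qed
  moreover have "matrix (f' x) $ i $ j = partial j f x $ i" if "x \<in> R" for x i
    using frechet_derivative_at[OF f[OF that]] by (simp add: matrix_def partial_def)
  ultimately have comp: "(\<lambda>x. partial j f x $ i) \<in> borel_measurable (lebesgue_on R)" for i
    by (subst measurable_cong[of _ _ "\<lambda>x. matrix (f' x) $ i $ j"]) auto
  show ?thesis
    by (rule borel_measurable_euclidean_space[THEN iffD2])
      (auto simp: Basis_vec_def inner_axis comp)
qed

text \<open>Used with \<open>q = 1/4\<close> for the gradients \<open>M\<close> of the flow map and \<open>N\<close> of the back-to-labels map: the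
  smallness of the displacement gradient controls \<open>N\<close> and thereby \<open>M\<close>.\<close>

lemma norm_le_if_left_inverse_near_id:
  fixes M N :: "'a::real_normed_vector \<Rightarrow>\<^sub>L 'a"
  assumes "N (M v) = v" and near: "\<And>w. norm (N w - w) \<le> q * norm w" and "q < 1"
  shows "norm (M v) \<le> norm v / (1 - q)"
proof -
  have "norm (M v) \<le> norm v + norm (v - M v)"
    by (smt (verit) norm_triangle_sub norm_minus_commute)
  also have "\<dots> \<le> norm v + q * norm (M v)"
    using near[of "M v"] assms(1) by simp
  finally show ?thesis using \<open>q < 1\<close> by (simp add: field_simps)
qed

section \<open>Vertical stretching of the flow map\<close>

context rotating_flow
begin

text \<open>The vertical component of Cauchy's formula. The term \<open>M \<zeta>\<close> has vertical component
  \<open>\<zeta> \<cdot> \<nabla>X\<^sub>3\<close>, and the planetary part contributes \<open>2 \<Omega> \<partial>X\<^sub>3/\<partial>a\<^sub>3\<close>.\<close>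

lemma vertical_stretching_identity:
  assumes "\<Omega> > 0" and t: "t \<in> {0..T}" and a: "a \<in> R"
  shows "X t differentiable (at a)"
    and "partial 3 (\<lambda>b. X t b $ 3) a = 1 + 1 / (2 * \<Omega>) *
      (curl (u t) (X t a) $ 3 - curl (u 0) a \<bullet> grad (\<lambda>b. X t b $ 3) a)"
proof -
  obtain M N :: "(real^3) \<Rightarrow>\<^sub>L (real^3)" where M: "(X t has_derivative M) (at a)"
    and cauchy: "curl (u t) (X t a) + (2 * \<Omega>) *\<^sub>R e3 = M (curl (u 0) a + (2 * \<Omega>) *\<^sub>R e3)"
    using flow_gradient[OF t a] by metis
  show "X t differentiable (at a)" using M by (rule differentiableI)
  let ?\<zeta> = "curl (u 0) a"
  have "?\<zeta> = (\<Sum>j\<in>UNIV. (?\<zeta> $ j) *\<^sub>R axis j 1)"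
    by (simp add: vec_eq_iff axis_def if_distrib cong: if_cong)
  then have "M ?\<zeta> = (\<Sum>j\<in>UNIV. (?\<zeta> $ j) *\<^sub>R M (axis j 1))"
    by (metis (no_types, lifting) blinfun.scaleR_right blinfun.sum_right sum.cong)
  then have "M ?\<zeta> $ 3 = ?\<zeta> \<bullet> grad (\<lambda>b. X t b $ 3) a"
    by (simp add: grad_def partial_component[OF M] inner_vec_def)
  moreover have "curl (u t) (X t a) $ 3 + 2 * \<Omega> = M ?\<zeta> $ 3 + 2 * \<Omega> * M e3 $ 3"
    using arg_cong[OF cauchy, of "\<lambda>w. w $ 3"]
    by (simp add: blinfun.add_right blinfun.scaleR_right)
  ultimately show "partial 3 (\<lambda>b. X t b $ 3) a = 1 + 1 / (2 * \<Omega>) *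
      (curl (u t) (X t a) $ 3 - ?\<zeta> \<bullet> grad (\<lambda>b. X t b $ 3) a)"
    using \<open>\<Omega> > 0\<close> by (simp add: partial_component[OF M] field_simps)
qed

lemma norm_curl_le:
  assumes t: "t \<in> {0..T}" and x: "x \<in> R"
  shows "ennreal (norm (curl (u t) x)) \<le> sup_vorticity R T u"
proof -
  have "continuous_on R (Pair t)" by (intro continuous_intros)
  then have "continuous_on R (\<lambda>x. frechet_derivative (u t) (at x) h)" for h
    using continuous_on_compose2[OF continuous_on_velocity_gradient[of h], of R "Pair t"] t by force
  then have "continuous_on R
      (\<lambda>x. \<Sum>i\<in>UNIV. cross3 (axis i 1) (frechet_derivative (u t) (at x) (axis i 1)))"
    by (intro continuous_on_sum continuous_on_cross continuous_on_const)
  then have "continuous_on R (curl (u t))"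
    by (rule continuous_on_eq) (simp add: curl_eq_sum_cross3[OF velocity_has_derivative[OF t]])
  from norm_le_Linf_norm[OF open_R this x] show ?thesis
    unfolding sup_vorticity_def using t by (intro SUP_upper2)
qed

text \<open>Solved for \<open>M e\<^sub>3 - e\<^sub>3 = \<partial>\<^sub>3(X - id)\<close>, Cauchy's formula reads
  \<open>2 \<Omega> (M e\<^sub>3 - e\<^sub>3) = \<omega>(X, t) - M \<zeta>\<close>. Both vorticities are at most
  \<open>c = \<rho> \<Omega>\<close> in norm and \<open>M\<close> has norm at most \<open>4/3\<close>, so that the left-hand side is at most
  \<open>7/3 c\<close> in norm; this gives the constant \<open>7/6\<close> in front of \<open>\<rho>\<close>, and \<open>9\<close> a fortiori.\<close>

lemma stretching_bound:
  assumes "\<Omega> > 0" and labels: "back_to_labels R T X A"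
    and finite: "sup_vorticity R T u < top"
    and t: "t \<in> {0..T}" and close: "sup_grad_norm R (\<lambda>x. A t x - x) \<le> ennreal (1/4)"
  shows "Linf_norm R (partial 3 (\<lambda>a. X t a - a)) \<le> 9 * local_rossby \<Omega> R T u"
proof -
  obtain c where "0 \<le> c" and c: "sup_vorticity R T u = ennreal c"
    using finite by (cases "sup_vorticity R T u") auto
  have curl_le: "norm (curl (u s) x) \<le> c" if "s \<in> {0..T}" "x \<in> R" for s x
    using norm_curl_le[OF that] \<open>0 \<le> c\<close> by (simp add: c)
  have diffX: "X t differentiable (at a)" if "a \<in> R" for a
    using vertical_stretching_identity(1)[OF \<open>\<Omega> > 0\<close> t that] .
  have contX: "continuous_on R (X t)"
    using diffX by (meson continuous_at_imp_continuous_on differentiable_imp_continuous_within)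
  have bound: "norm (partial 3 (\<lambda>a. X t a - a) a) \<le> 9 * (c / \<Omega>)" if a: "a \<in> R" for a
  proof -
    let ?x = "X t a"
    have x: "?x \<in> R" using X_in_R[OF t a] .
    obtain M N :: "(real^3) \<Rightarrow>\<^sub>L (real^3)" where M: "(X t has_derivative M) (at a)"
      and MN: "\<And>v. M (N v) = v" and NM: "\<And>v. N (M v) = v"
      and cauchy: "curl (u t) ?x + (2 * \<Omega>) *\<^sub>R e3 = M (curl (u 0) a + (2 * \<Omega>) *\<^sub>R e3)"
      using flow_gradient[OF t a] by metis
    have "(A t has_derivative N) (at ?x)"
      by (rule has_derivative_inverse_strong[OF open_R a contX _ M])
        (use labels t MN in \<open>auto simp: back_to_labels_def\<close>)
    then have "((\<lambda>y. A t y - y) has_derivative (\<lambda>w. N w - w)) (at ?x)"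
      by (intro derivative_intros)
    note dA = this frechet_derivative_at[OF this, symmetric]
    have "ennreal (onorm (\<lambda>w. N w - w)) \<le> ennreal (1/4)"
      using close SUP_upper[OF x, of "\<lambda>x. ennreal (onorm (frechet_derivative (\<lambda>y. A t y - y) (at x)))"]
      unfolding sup_grad_norm_def dA(2) by (rule order_trans[rotated])
    then have "onorm (\<lambda>w. N w - w) \<le> 1/4" by (simp add: ennreal_le_iff)
    then have "norm (N w - w) \<le> 1/4 * norm w" for w
      using onorm[OF has_derivative_bounded_linear[OF dA(1)], of w]
      by (meson mult_right_mono norm_ge_zero order_trans)
    from norm_le_if_left_inverse_near_id[OF NM this]
    have M_le: "norm (M v) \<le> 4/3 * norm v" for v by (simp add: field_simps)
    have "((\<lambda>b. X t b - b) has_derivative (\<lambda>h. M h - h)) (at a)"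
      by (intro derivative_intros M)
    from frechet_derivative_at[OF this, symmetric]
    have "(2 * \<Omega>) *\<^sub>R partial 3 (\<lambda>a. X t a - a) a = (2 * \<Omega>) *\<^sub>R M e3 - (2 * \<Omega>) *\<^sub>R e3"
      by (simp add: partial_def scaleR_diff_right)
    also have "\<dots> = curl (u t) ?x - M (curl (u 0) a)"
      using cauchy by (simp add: blinfun.add_right blinfun.scaleR_right algebra_simps)
    finally have stretch: "(2 * \<Omega>) *\<^sub>R partial 3 (\<lambda>a. X t a - a) a =
      curl (u t) ?x - M (curl (u 0) a)" .
    have "2 * \<Omega> * norm (partial 3 (\<lambda>a. X t a - a) a) = norm (curl (u t) ?x - M (curl (u 0) a))"
      unfolding stretch[symmetric] using \<open>\<Omega> > 0\<close> by simp
    also have "\<dots> \<le> norm (curl (u t) ?x) + norm (M (curl (u 0) a))"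
      by (rule norm_triangle_ineq4)
    also have "\<dots> \<le> c + 4/3 * c"
      using curl_le[OF t x] M_le[of "curl (u 0) a"] curl_le[of 0 a] a T_pos by force
    also have "\<dots> \<le> 18 * c" using \<open>0 \<le> c\<close> by simp
    finally show ?thesis using \<open>\<Omega> > 0\<close> by (simp add: field_simps)
  qed
  have "partial 3 (\<lambda>a. X t a - a) \<in> borel_measurable (lebesgue_on R)"
  proof (rule borel_measurable_partial[OF open_R])
    show "((\<lambda>a. X t a - a) has_derivative (\<lambda>h. frechet_derivative (X t) (at a) h - h)) (at a)"
      if "a \<in> R" for a
      using diffX[OF that] by (intro derivative_intros) (simp add: frechet_derivative_works)
  qed
  from Linf_norm_le[OF this bound]
  have "Linf_norm R (partial 3 (\<lambda>a. X t a - a)) \<le> ennreal (9 * (c / \<Omega>))" .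
  also have "\<dots> = 9 * local_rossby \<Omega> R T u"
    using ennreal_mult[of 9 "c / \<Omega>"] \<open>0 \<le> c\<close> \<open>\<Omega> > 0\<close>
    by (simp add: local_rossby_def c divide_ennreal)
  finally show ?thesis .
qed

end

theorem proposition3:
  fixes R :: "(real^3) set" and n :: "real^3 \<Rightarrow> real^3" and \<Omega> T :: real
    and u :: "real \<Rightarrow> real^3 \<Rightarrow> real^3" and p :: "real \<Rightarrow> real^3 \<Rightarrow> real"
    and X A :: "real \<Rightarrow> real^3 \<Rightarrow> real^3"
  assumes "\<Omega> > 0" and "T > 0"
    and "smooth_domain R n"
    and "rotating_euler_solution \<Omega> R n T u p"
    and "lagrangian_map R T u X"
    and "back_to_labels R T X A"
    and "sup_vorticity R T u < top"
  shows "(\<forall>t\<in>{0..T}. \<forall>a\<in>R.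
            X t differentiable (at a) \<and>
            partial 3 (\<lambda>b. X t b $ 3) a =
              1 + 1 / (2 * \<Omega>) *
                (curl (u t) (X t a) $ 3 - curl (u 0) a \<bullet> grad (\<lambda>b. X t b $ 3) a))
       \<and> (\<forall>I. is_interval I \<and> I \<subseteq> {0..T} \<and>
            (SUP t\<in>I. sup_grad_norm R (\<lambda>x. A t x - x)) \<le> ennreal (1/4) \<and>
            local_rossby \<Omega> R T u \<le> ennreal (1/4) \<longrightarrow>
            (SUP t\<in>I. Linf_norm R (partial 3 (\<lambda>a. X t a - a))) \<le> 9 * local_rossby \<Omega> R T u)"
proof -
  interpret rotating_flow R n \<Omega> T u p X
    by (intro rotating_flow.intro assms) (use assms(3) in \<open>simp add: smooth_domain_def\<close>)
  show ?thesis
  proof (intro conjI ballI allI impI SUP_least)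
    fix t a assume "t \<in> {0..T}" "a \<in> R"
    then show "X t differentiable (at a)"
      and "partial 3 (\<lambda>b. X t b $ 3) a = 1 + 1 / (2 * \<Omega>) *
        (curl (u t) (X t a) $ 3 - curl (u 0) a \<bullet> grad (\<lambda>b. X t b $ 3) a)"
      by (rule vertical_stretching_identity[OF \<open>\<Omega> > 0\<close>])+
  next
    fix I t
    assume I: "is_interval I \<and> I \<subseteq> {0..T} \<and>
      (SUP t\<in>I. sup_grad_norm R (\<lambda>x. A t x - x)) \<le> ennreal (1/4) \<and>
      local_rossby \<Omega> R T u \<le> ennreal (1/4)" and t: "t \<in> I"
    have "sup_grad_norm R (\<lambda>x. A t x - x) \<le> ennreal (1/4)"
      using I SUP_upper[OF t] by (meson order_trans)
    then show "Linf_norm R (partial 3 (\<lambda>a. X t a - a)) \<le> 9 * local_rossby \<Omega> R T u"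
      using stretching_bound[OF assms(1,6,7)] I t by blast
  qed
qed

end
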